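(* Let $(X,\|\cdot\|)$ be an $n$-dimensional real normed linear space ($n\ge2$) such that the derivative of the norm is Lipschitz on the unit sphere (e.g., $X=\ell^p_n$, $p\ge2$). Consider on $(X,\|\cdot\|)$ an arbitrary equivalent Hilbert norm $\|\cdot\|_H$. Let $F\subset X$ be a nonempty closed set. Then, for all $r>0$ except a countable set, the distance sphere $S_r(F):=\{x\in X:\ \mathrm{dist}_{\|\cdot\|}(x,F)=r\}$ is either empty, or there exists an $(n-1)$-dimensional semiconcave surface $A_r$ in $(X,\|\cdot\|_H)$ such that $A_r\subset S_r(F)$, $A_r$ is open and dense in $S_r(F)$, and $\mathcal{H}^{n-1}(S_r(F)\setminus A_r)=0$.
   Context: $\mathcal{H}^s$ denotes $s$-dimensional Hausdorff measure. $\mathrm{dist}_{\|\cdot\|}(x,F)=\inf_{y\in F}\|x-y\|$. $\ell^p_n$ is $\mathbb{R}^n$ with the $\ell^p$ norm. A Hilbert norm is one induced by an inner product. Semiconcavity: on an open convex subset $C$ of a real inner product space $H$, $u:C\to\mathbb{R}$ is semiconcave if for some constant $c$ the function $x\mapsto u(x)-(c/2)\|x\|^2$ is concave on $C$. A function on an open set $G\subset H$ is locally semiconcave if for each $x\in G$ there is $\delta>0$ such that it is semiconcave on $B(x,\delta)$. Semiconcave surface: let $H$ be an $n$-dimensional real inner product space, $n\ge2$. A nonempty set $M\subset H$ is an $(n-1)$-dimensional semiconcave surface in $H$ if for each $x\in M$ there exist an $(n-1)$-dimensional linear subspace $Q\subset H$, an open neighbourhood $W$ of $x$, a set $D\subset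 Q$ open in $Q$, a vector $0\ne v\in Q^\perp$ and a locally semiconcave function $s:D\to\mathbb{R}$ such that $M\cap W=\{u+s(u)v:u\in D\}$. *)

theory Defs
  imports "HOL-Analysis.Analysis"
begin

text \<open>
  Throughout, the Hilbert space \<open>H = (X, \<parallel>\<cdot>\<parallel>\<^sub>H)\<close> is the type \<open>'a :: euclidean_space\<close> itself, i.e. an
  arbitrary finite-dimensional real inner product space, and \<open>\<parallel>\<cdot>\<parallel>\<^sub>H\<close> is the class constant
  \<^const>\<open>norm\<close>.  The given norm of \<open>X\<close> is an explicit function \<open>N :: 'a \<Rightarrow> real\<close>.  Since \<open>N\<close> and
  \<^const>\<open>norm\<close> are equivalent, the class topology and Frechet differentiability
  (\<^const>\<open>has_derivative\<close>) are those of \<open>(X, N)\<close> as well.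
\<close>

definition is_norm :: "('a::real_vector \<Rightarrow> real) \<Rightarrow> bool" where
  "is_norm N \<longleftrightarrow>
     (\<forall>x. 0 \<le> N x) \<and> (\<forall>x. N x = 0 \<longleftrightarrow> x = 0) \<and>
     (\<forall>c x. N (c *\<^sub>R x) = \<bar>c\<bar> * N x) \<and> (\<forall>x y. N (x + y) \<le> N x + N y)"

definition equivalent_norms :: "('a \<Rightarrow> real) \<Rightarrow> ('a \<Rightarrow> real) \<Rightarrow> bool" where
  "equivalent_norms N N' \<longleftrightarrow> (\<exists>a>0. \<exists>b>0. \<forall>x. a * N x \<le> N' x \<and> N' x \<le> b * N x)"

text \<open>Operator norm of a functional on \<open>(X, N)\<close>, in the style of \<^const>\<open>onorm\<close>
  (the point \<open>h = 0\<close> contributes \<open>0\<close>).\<close>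

definition dual_norm :: "('a \<Rightarrow> real) \<Rightarrow> ('a \<Rightarrow> real) \<Rightarrow> real" where
  "dual_norm N T = (SUP h. \<bar>T h\<bar> / N h)"

definition norm_deriv_lipschitz_on_sphere :: "('a::euclidean_space \<Rightarrow> real) \<Rightarrow> bool" where
  "norm_deriv_lipschitz_on_sphere N \<longleftrightarrow>
     (\<forall>x. N x = 1 \<longrightarrow> N differentiable (at x)) \<and>
     (\<exists>L. \<forall>x y. N x = 1 \<longrightarrow> N y = 1 \<longrightarrow>
        dual_norm N (\<lambda>h. frechet_derivative N (at x) h - frechet_derivative N (at y) h)
          \<le> L * N (x - y))"

definition dist_fun :: "('a::real_vector \<Rightarrow> real) \<Rightarrow> 'a \<Rightarrow> 'a set \<Rightarrow> real" where
  "dist_fun N x F = (INF y\<in>F. N (x - y))"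

definition dist_sphere :: "('a::real_vector \<Rightarrow> real) \<Rightarrow> real \<Rightarrow> 'a set \<Rightarrow> 'a set" where
  "dist_sphere N r F = {x. dist_fun N x F = r}"

text \<open>Hausdorff measure of integer dimension \<open>k\<close> for a distance function \<open>d\<close>, with the usual factor
  \<open>\<omega>\<^sub>k / 2\<^sup>k\<close>.  The empty set has weight \<open>0\<close> also for \<open>k = 0\<close>, where \<open>0 ^ 0 = 1\<close>.\<close>

definition ediam :: "('a \<Rightarrow> 'a \<Rightarrow> real) \<Rightarrow> 'a set \<Rightarrow> ennreal" where
  "ediam d C = (SUP x\<in>C. SUP y\<in>C. ennreal (d x y))"

definition hausdorff_weight :: "('a \<Rightarrow> 'a \<Rightarrow> real) \<Rightarrow> nat \<Rightarrow> 'a set \<Rightarrow> ennreal" where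
  "hausdorff_weight d k C =
     (if C = {} then 0 else ennreal (unit_ball_vol (real k) / 2 ^ k) * ediam d C ^ k)"

definition hausdorff_content :: "('a \<Rightarrow> 'a \<Rightarrow> real) \<Rightarrow> nat \<Rightarrow> real \<Rightarrow> 'a set \<Rightarrow> ennreal" where
  "hausdorff_content d k \<delta> A =
     (INF C\<in>{C :: nat \<Rightarrow> 'a set. A \<subseteq> (\<Union>i. C i) \<and> (\<forall>i. ediam d (C i) \<le> ennreal \<delta>)}.
        \<Sum>i. hausdorff_weight d k (C i))"

definition hausdorff_measure :: "('a \<Rightarrow> 'a \<Rightarrow> real) \<Rightarrow> nat \<Rightarrow> 'a set \<Rightarrow> ennreal" where
  "hausdorff_measure d k A = (SUP \<delta>\<in>{0<..}. hausdorff_content d k \<delta> A)"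

text \<open>Convexity of \<open>C\<close> is part of \<^const>\<open>concave_on\<close>.\<close>

definition semiconcave_on :: "'a::real_inner set \<Rightarrow> ('a \<Rightarrow> real) \<Rightarrow> bool" where
  "semiconcave_on C u \<longleftrightarrow> (\<exists>c. concave_on C (\<lambda>x. u x - (c / 2) * (norm x)\<^sup>2))"

text \<open>Local semiconcavity of a function on a subset \<open>G\<close> of the inner product space \<open>Q\<close>, where \<open>Q\<close> is
  a linear subspace and \<open>G\<close> is open in \<open>Q\<close>; the balls of \<open>Q\<close> are the sets \<open>ball x \<delta> \<inter> Q\<close>.  Values of
  \<open>s\<close> outside \<open>G\<close> are irrelevant.\<close>

definition locally_semiconcave_in :: "'a::real_inner set \<Rightarrow> 'a set \<Rightarrow> ('a \<Rightarrow> real) \<Rightarrow> bool" where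
  "locally_semiconcave_in Q G s \<longleftrightarrow>
     (\<forall>x\<in>G. \<exists>\<delta>>0. ball x \<delta> \<inter> Q \<subseteq> G \<and> semiconcave_on (ball x \<delta> \<inter> Q) s)"

definition semiconcave_surface :: "'a::euclidean_space set \<Rightarrow> bool" where
  "semiconcave_surface M \<longleftrightarrow>
     M \<noteq> {} \<and>
     (\<forall>x\<in>M. \<exists>Q W D v s.
        subspace Q \<and> dim Q = DIM('a) - 1 \<and>
        open W \<and> x \<in> W \<and>
        openin (top_of_set Q) D \<and>
        v \<noteq> 0 \<and> v \<in> orthogonal_comp Q \<and>
        locally_semiconcave_in Q D s \<and>
        M \<inter> W = (\<lambda>u. u + s u *\<^sub>R v) ` D)"

end

theory Submission imports Defs begin

text \<open>
  Let \<open>d\<close> be the distance function of \<open>F\<close> for the norm \<open>N\<close>.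

  If \<open>y\<close> is a point of \<open>F\<close> nearest to \<open>z\<close>, the function \<open>w \<mapsto> N (w - y)\<close> lies above \<open>d\<close> and touches it at
  \<open>z\<close>.  As the derivative of \<open>N\<close> is Lipschitz away from \<open>0\<close>, this function has a quadratic upper Taylor
  bound, and its gradient \<open>p\<close> at \<open>z\<close> is bounded away from \<open>0\<close>.  So near every point off \<open>F\<close> there is one
  constant \<open>C\<close> such that every \<open>z\<close> has a \<^emph>\<open>supergradient\<close> \<open>p\<close> of \<open>d\<close>, that is
  \<open>d w \<le> d z + p \<bullet> (w - z) + C * (norm (w - z))\<^sup>2\<close>, with \<open>norm p \<ge> m > 0\<close>
  (\<open>dist_fun_supergradients\<close>).  The bound by a single quadratic makes
  \<open>d\<close> locally semiconcave; the lower bound \<open>m\<close> keeps it from having a flat supergradient only.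

  Call \<open>x\<close> a \<^emph>\<open>descent point\<close> if \<open>d\<close> decreases at a definite rate in one fixed direction \<open>v\<close> at all points
  near \<open>x\<close>.  Near such a point a level set of \<open>d\<close> is the graph of a Lipschitz function over the
  hyperplane orthogonal to \<open>v\<close>, and this function inherits semiconcavity from \<open>d\<close>
  (\<open>level_set_semiconcave_graph\<close>).  The surface \<open>A\<close> consists of the descent points on the distance
  sphere; it is relatively open because the definition of a descent point is an open condition.

  At a point that is not a descent point, a separation argument shows that \<open>0\<close> is a supergradient
  (\<open>descent_or_zero_supergradient\<close>).  Then \<open>d\<close> has two supergradients there, \<open>0\<close> and a vector \<open>p\<close> with
  \<open>norm p \<ge> m\<close>.  Comparing two such points \<open>x\<close>, \<open>y\<close> that are close together and whose vectors \<open>p\<close> are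
  close to the same \<open>q\<close> shows that \<open>y - x\<close> is nearly orthogonal to \<open>q\<close>.  Hence the points that are not
  descent points are covered by countably many sets \<^emph>\<open>transversal\<close> to some direction
  (\<open>nondescent_points_countable_transversal\<close>).

  On a compact transversal set \<open>K\<close> all but countably many level sets of \<open>d\<close> have vanishing
  \<open>(n - 1)\<close>-dimensional measure (\<open>countable_nonnull_levels\<close>): the segments of length \<open>1\<close> in the
  transversal direction that start in \<open>K\<close> are disjoint, so the level sets of \<open>K\<close> sweep out disjoint
  compact sets within a set of finite Lebesgue measure, and a set that sweeps out a Lebesgue null set
  is a Hausdorff null set by a packing argument.  Together with the previous paragraph this gives
  the measure statement for all but countably many \<open>r\<close>.

  Finally, a function on a second-countable space has only countably many local maximum and minimum values.
  If \<open>r\<close> is none of them, every ball around a point of the distance sphere meets both \<open>{d < r}\<close> and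
  \<open>{d > r}\<close>.  The sphere then separates two small balls, and so its part in the ball is not a
  Hausdorff null set (\<open>level_set_not_hausdorff_null\<close>).  Since the complement of \<open>A\<close> in the sphere is a
  null set, \<open>A\<close> is dense.
\<close>

section \<open>Hausdorff null sets and coverings by balls\<close>

lemma is_normD:
  assumes "is_norm N"
  shows "0 \<le> N x" "N x = 0 \<longleftrightarrow> x = 0" "N (c *\<^sub>R x) = \<bar>c\<bar> * N x" "N (x + y) \<le> N x + N y"
  using assms unfolding is_norm_def by blast+

lemma hausdorff_null_subset:
  assumes "hausdorff_measure d k B = 0" "A \<subseteq> B"
  shows "hausdorff_measure d k A = 0"
proof -
  have "hausdorff_measure d k A \<le> hausdorff_measure d k B"
    unfolding hausdorff_measure_def hausdorff_content_def
    using assms(2) by (intro SUP_mono' INF_superset_mono) auto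
  then show ?thesis using assms(1) by simp
qed

lemma ediam_cball_le:
  assumes "is_norm N" and eq: "\<And>x. a * N x \<le> norm x" and "0 < a" "0 \<le> \<rho>"
  shows "ediam (\<lambda>x y. N (x - y)) (cball c \<rho>) \<le> ennreal (2 * \<rho> / a)"
  unfolding ediam_def
proof (intro SUP_least ennreal_leI)
  fix x y assume "x \<in> cball c \<rho>" "y \<in> cball c \<rho>"
  then have "norm (x - y) \<le> 2 * \<rho>"
    using dist_triangle_le[of x c y "2 * \<rho>"] by (auto simp: dist_commute dist_norm)
  with eq[of "x - y"] have "a * N (x - y) \<le> 2 * \<rho>" by linarith
  then show "N (x - y) \<le> 2 * \<rho> / a" using \<open>0 < a\<close> by (simp add: field_simps)
qed

text \<open>
  Null sets are easier to handle through coverings by Euclidean balls with small sums of powers of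
  the radii: this turns diameters for \<open>N\<close>, suprema and weights into real numbers.  Replacing \<open>N\<close> by the
  Euclidean norm costs only a constant factor.  This lemma and the next one give both directions.
  Radius \<open>0\<close> is admitted here so that a finite covering can be padded to an infinite one.
\<close>

lemma hausdorff_null_if_ball_covers:
  fixes A :: "'a::euclidean_space set"
  assumes N: "is_norm N" and eq: "\<And>x. a * N x \<le> norm x" and a: "0 < a" and k: "0 < k"
    and cov: "\<And>\<epsilon> \<delta>. 0 < \<epsilon> \<Longrightarrow> 0 < \<delta> \<Longrightarrow>
       \<exists>(c::nat \<Rightarrow> 'a) \<rho>. (\<forall>i. 0 \<le> \<rho> i \<and> \<rho> i \<le> \<delta>) \<and> A \<subseteq> (\<Union>i. cball (c i) (\<rho> i)) \<and>
         (\<Sum>i. ennreal (\<rho> i ^ k)) \<le> ennreal \<epsilon>"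
  shows "hausdorff_measure (\<lambda>x y. N (x - y)) k A = 0"
proof -
  let ?d = "\<lambda>x y. N (x - y)"
  have "hausdorff_content ?d k \<delta> A = 0" if \<delta>: "0 < \<delta>" for \<delta>
  proof -
    have *: "hausdorff_content ?d k \<delta> A \<le> 0 + ennreal e" if e: "0 < e" for e
    proof -
      define K where "K = unit_ball_vol (real k) / 2 ^ k * (2 / a) ^ k"
      have K: "0 < K" using a by (simp add: K_def)
      obtain c :: "nat \<Rightarrow> 'a" and \<rho> where c: "\<And>i. 0 \<le> \<rho> i" "\<And>i. \<rho> i \<le> \<delta> * a / 2"
        "A \<subseteq> (\<Union>i. cball (c i) (\<rho> i))" "(\<Sum>i. ennreal (\<rho> i ^ k)) \<le> ennreal (e / K)"
        using cov[of "e / K" "\<delta> * a / 2"] e K \<delta> a by auto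
      have diam: "ediam ?d (cball (c i) (\<rho> i)) \<le> ennreal (2 * \<rho> i / a)" for i
        using ediam_cball_le[OF N eq a c(1)] .
      have "hausdorff_content ?d k \<delta> A \<le> (\<Sum>i. hausdorff_weight ?d k (cball (c i) (\<rho> i)))"
        unfolding hausdorff_content_def
      proof (rule INF_lower, intro CollectI conjI allI c(3))
        fix i
        have "2 * \<rho> i / a \<le> \<delta>" using c(2)[of i] a by (simp add: field_simps)
        then show "ediam ?d (cball (c i) (\<rho> i)) \<le> ennreal \<delta>"
          using diam[of i] by (meson ennreal_leI order_trans)
      qed
      also have "\<dots> \<le> (\<Sum>i. ennreal K * ennreal (\<rho> i ^ k))"
      proof (intro suminf_le summableI)
        fix i
        have "hausdorff_weight ?d k (cball (c i) (\<rho> i))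
            \<le> ennreal (unit_ball_vol (real k) / 2 ^ k) * ediam ?d (cball (c i) (\<rho> i)) ^ k"
          by (simp add: hausdorff_weight_def)
        also have "\<dots> \<le> ennreal (unit_ball_vol (real k) / 2 ^ k) * ennreal (2 * \<rho> i / a) ^ k"
          by (intro mult_left_mono power_mono diam) auto
        also have "\<dots> = ennreal (unit_ball_vol (real k) / 2 ^ k * (2 * \<rho> i / a) ^ k)"
          using c(1)[of i] a by (subst ennreal_mult) (simp_all add: ennreal_power)
        also have "\<dots> = ennreal K * ennreal (\<rho> i ^ k)"
          using c(1)[of i] K by (simp add: K_def ennreal_mult'[symmetric] power_mult_distrib power_divide)
        finally show "hausdorff_weight ?d k (cball (c i) (\<rho> i)) \<le> ennreal K * ennreal (\<rho> i ^ k)" .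
      qed
      also have "\<dots> = ennreal K * (\<Sum>i. ennreal (\<rho> i ^ k))" by (rule ennreal_suminf_cmult)
      also have "\<dots> \<le> ennreal K * ennreal (e / K)" by (intro mult_left_mono c(4)) auto
      also have "\<dots> = ennreal e" using K e by (simp add: ennreal_mult[symmetric])
      finally show ?thesis by simp
    qed
    have "hausdorff_content ?d k \<delta> A \<le> 0" by (rule ennreal_le_epsilon) (rule *)
    then show ?thesis by simp
  qed
  then have "hausdorff_measure ?d k A \<le> 0"
    unfolding hausdorff_measure_def by (intro SUP_least) simp
  then show ?thesis by simp
qed

text \<open>
  A set of diameter \<open>D\<close> is contained in a ball of radius \<open>b * D\<close> around any of its points.  The radius is
  also kept above a term of a geometric series, so that it is positive for sets of diameter \<open>0\<close> too.
\<close>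

lemma ball_cover_if_hausdorff_null:
  fixes A :: "'a::euclidean_space set"
  assumes N: "is_norm N" and eq: "\<And>x. norm x \<le> b * N x" and b: "0 < b" and k: "0 < k"
    and null: "hausdorff_measure (\<lambda>x y. N (x - y)) k A = 0"
    and \<epsilon>: "0 < \<epsilon>" and \<delta>: "0 < \<delta>"
  obtains c :: "nat \<Rightarrow> 'a" and \<rho> where "\<And>i. 0 < \<rho> i" "\<And>i. \<rho> i \<le> \<delta>"
    "A \<subseteq> (\<Union>i. cball (c i) (\<rho> i))" "(\<Sum>i. ennreal (\<rho> i ^ k)) \<le> ennreal \<epsilon>"
proof -
  let ?d = "\<lambda>x y. N (x - y)"
  define \<omega> where "\<omega> = unit_ball_vol (real k) / 2 ^ k"
  have \<omega>: "0 < \<omega>" by (simp add: \<omega>_def)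
  define \<eta> where "\<eta> = min 1 (min \<delta> (\<epsilon> / 4))"
  have \<eta>: "0 < \<eta>" "\<eta> \<le> 1" "\<eta> \<le> \<delta>" "\<eta> \<le> \<epsilon> / 4" using \<epsilon> \<delta> by (auto simp: \<eta>_def)
  \<comment> \<open>after passing from weights to radii this bound contributes \<open>\<epsilon> / 4\<close>\<close>
  define \<tau> where "\<tau> = \<omega> * \<epsilon> / (4 * b ^ k)"
  have \<tau>: "0 < \<tau>" using \<omega> \<epsilon> b by (simp add: \<tau>_def)
  have "hausdorff_content ?d k (\<delta> / b) A \<le> hausdorff_measure ?d k A"
    unfolding hausdorff_measure_def using \<delta> b by (intro SUP_upper) auto
  then have "hausdorff_content ?d k (\<delta> / b) A < ennreal \<tau>" using null \<tau> by simp
  then obtain C :: "nat \<Rightarrow> 'a set" where C: "A \<subseteq> (\<Union>i. C i)"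
     "\<And>i. ediam ?d (C i) \<le> ennreal (\<delta> / b)" "(\<Sum>i. hausdorff_weight ?d k (C i)) < ennreal \<tau>"
    unfolding hausdorff_content_def INF_less_iff by auto
  define D where "D i = enn2real (ediam ?d (C i))" for i
  have D: "ediam ?d (C i) = ennreal (D i)" "0 \<le> D i" "D i \<le> \<delta> / b" for i
  proof -
    have fin: "ediam ?d (C i) < top" using C(2)[of i] ennreal_less_top le_less_trans by blast
    then show "ediam ?d (C i) = ennreal (D i)" by (simp add: D_def)
    then show "D i \<le> \<delta> / b" using C(2)[of i] \<delta> b by simp
  qed (simp add: D_def)
  define c where "c i = (SOME x. x \<in> C i)" for i
  \<comment> \<open>the index-dependent lower bound keeps the radii positive, and its sum is at most \<open>\<epsilon> / 4\<close>\<close>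
  define \<rho> where "\<rho> i = (if C i = {} then \<eta> * (1 / 2) ^ Suc i else max (b * D i) (\<eta> * (1 / 2) ^ Suc i))" for i
  have half: "\<eta> * (1 / 2) ^ Suc i \<le> \<eta>" "0 < \<eta> * (1 / 2) ^ Suc i" for i
    using \<eta>(1) by (auto intro!: mult_right_le_one_le power_le_one simp del: power_Suc)
  have "0 < \<rho> i" for i using half[of i] by (auto simp: \<rho>_def)
  moreover have "\<rho> i \<le> \<delta>" for i
  proof -
    have "b * D i \<le> \<delta>" using D(3)[of i] b by (simp add: field_simps)
    moreover have "\<eta> * (1 / 2) ^ Suc i \<le> \<delta>" using half(1)[of i] \<eta>(3) by linarith
    ultimately show ?thesis unfolding \<rho>_def by simp
  qed
  moreover have "A \<subseteq> (\<Union>i. cball (c i) (\<rho> i))"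
  proof
    fix x assume "x \<in> A"
    then obtain i where i: "x \<in> C i" using C(1) by auto
    then have ci: "c i \<in> C i" unfolding c_def by (rule someI)
    have "ennreal (N (c i - x)) \<le> ediam ?d (C i)"
      unfolding ediam_def using i ci by (intro SUP_upper2[OF ci] SUP_upper2[OF i]) auto
    then have "N (c i - x) \<le> D i" using D(1,2)[of i] by simp
    then have "norm (c i - x) \<le> b * D i" using eq[of "c i - x"] b
      by (meson mult_left_mono order_less_imp_le order_trans)
    then have "dist (c i) x \<le> \<rho> i" using i by (auto simp: \<rho>_def dist_norm)
    then show "x \<in> (\<Union>i. cball (c i) (\<rho> i))" by auto
  qed
  moreover have "(\<Sum>i. ennreal (\<rho> i ^ k)) \<le> ennreal \<epsilon>"
  proof -
    have "(\<Sum>i. ennreal (\<rho> i ^ k)) \<le> (\<Sum>i. ennreal (b ^ k / \<omega>) * hausdorff_weight ?d k (C i) + ennreal (\<eta> * (1 / 2) ^ Suc i))"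
    proof (intro suminf_le summableI)
      fix i
      have p: "(\<eta> * (1 / 2) ^ Suc i) ^ k \<le> \<eta> * (1 / 2) ^ Suc i"
        using half[of i] \<eta>(2) k power_decreasing[of 1 k "\<eta> * (1 / 2) ^ Suc i"]
        by (simp only: power_one_right)
      show "ennreal (\<rho> i ^ k) \<le> ennreal (b ^ k / \<omega>) * hausdorff_weight ?d k (C i) + ennreal (\<eta> * (1 / 2) ^ Suc i)"
      proof (cases "C i = {}")
        case True
        then show ?thesis using p by (simp add: \<rho>_def hausdorff_weight_def ennreal_leI del: power_Suc)
      next
        case False
        have "\<rho> i ^ k \<le> (b * D i) ^ k + (\<eta> * (1 / 2) ^ Suc i) ^ k"
          using False half(2)[of i] D(2)[of i] b by (auto simp: \<rho>_def max_def simp del: power_Suc)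
        also have "\<dots> \<le> (b * D i) ^ k + \<eta> * (1 / 2) ^ Suc i" using p by simp
        finally have "ennreal (\<rho> i ^ k) \<le> ennreal ((b * D i) ^ k + \<eta> * (1 / 2) ^ Suc i)" by (rule ennreal_leI)
        also have "\<dots> = ennreal ((b * D i) ^ k) + ennreal (\<eta> * (1 / 2) ^ Suc i)"
          using D(2)[of i] b half(2)[of i] by (intro ennreal_plus) auto
        also have "ennreal ((b * D i) ^ k) = ennreal (b ^ k / \<omega>) * hausdorff_weight ?d k (C i)"
        proof -
          have "hausdorff_weight ?d k (C i) = ennreal (\<omega> * D i ^ k)"
            using False D(1,2)[of i] \<omega> unfolding hausdorff_weight_def
            by (simp add: \<omega>_def[symmetric] ennreal_mult ennreal_power)
          then show ?thesis using \<omega> b D(2)[of i] by (simp add: ennreal_mult[symmetric] power_mult_distrib)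
        qed
        finally show ?thesis .
      qed
    qed
    also have "\<dots> = ennreal (b ^ k / \<omega>) * (\<Sum>i. hausdorff_weight ?d k (C i)) + (\<Sum>i. ennreal (\<eta> * (1 / 2) ^ Suc i))"
      by (simp only: suminf_add[OF summableI summableI, symmetric] ennreal_suminf_cmult)
    also have "(\<Sum>i. ennreal (\<eta> * (1 / 2) ^ Suc i)) = ennreal \<eta>"
      using half(2) sums_mult[OF power_half_series, of \<eta>] by (intro suminf_ennreal_eq) (auto simp: less_imp_le)
    also have "ennreal (b ^ k / \<omega>) * (\<Sum>i. hausdorff_weight ?d k (C i)) + ennreal \<eta>
       \<le> ennreal (b ^ k / \<omega>) * ennreal \<tau> + ennreal \<eta>"
      using C(3) by (intro add_right_mono mult_left_mono) auto
    also have "\<dots> = ennreal (b ^ k / \<omega> * \<tau> + \<eta>)"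
      using \<omega> b \<tau> \<eta>(1) by (simp add: ennreal_mult[symmetric])
    also have "\<dots> \<le> ennreal \<epsilon>"
      using \<omega> b \<eta>(4) \<epsilon> by (intro ennreal_leI) (simp add: \<tau>_def)
    finally show ?thesis .
  qed
  ultimately show thesis by (rule that)
qed

lemma hausdorff_null_UN:
  fixes A :: "nat \<Rightarrow> 'a::euclidean_space set"
  assumes N: "is_norm N" and eqv: "equivalent_norms N norm" and k: "0 < k"
    and null: "\<And>j. hausdorff_measure (\<lambda>x y. N (x - y)) k (A j) = 0"
  shows "hausdorff_measure (\<lambda>x y. N (x - y)) k (\<Union>j. A j) = 0"
proof -
  obtain a b where ab: "a > 0" "b > 0" "\<And>x. a * N x \<le> norm x" "\<And>x. norm x \<le> b * N x"
    using eqv unfolding equivalent_norms_def by blast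
  show ?thesis
  proof (rule hausdorff_null_if_ball_covers[OF N ab(3) ab(1) k])
    fix \<epsilon> \<delta> :: real assume e: "0 < \<epsilon>" "0 < \<delta>"
    define P where "P j c \<rho> \<longleftrightarrow> (\<forall>i. 0 < \<rho> i \<and> \<rho> i \<le> \<delta>) \<and> A j \<subseteq> (\<Union>i. cball (c i) (\<rho> i)) \<and>
        (\<Sum>i. ennreal (\<rho> i ^ k)) \<le> ennreal (\<epsilon> * (1 / 2) ^ Suc j)" for j and c :: "nat \<Rightarrow> 'a" and \<rho>
    have "\<exists>c \<rho>. P j c \<rho>" for j
      unfolding P_def
      by (rule ball_cover_if_hausdorff_null[OF N ab(4,2) k null, of "\<epsilon> * (1 / 2) ^ Suc j" \<delta>])
        (use e in auto)
    then obtain c \<rho> where "\<And>j. P j (c j) (\<rho> j)" by metis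
    then have c: "\<And>j i. 0 < \<rho> j i" "\<And>j i. \<rho> j i \<le> \<delta>"
      "\<And>j. A j \<subseteq> (\<Union>i::nat. cball (c j i) (\<rho> j i))"
      "\<And>j. (\<Sum>i. ennreal (\<rho> j i ^ k)) \<le> ennreal (\<epsilon> * (1 / 2) ^ Suc j)"
      by (simp_all add: P_def)
    define c' where "c' n = (case prod_decode n of (j, i) \<Rightarrow> c j i)" for n
    define \<rho>' where "\<rho>' n = (case prod_decode n of (j, i) \<Rightarrow> \<rho> j i)" for n
    have "0 \<le> \<rho>' n \<and> \<rho>' n \<le> \<delta>" for n
      using c(1,2) by (auto simp: \<rho>'_def less_imp_le split: prod.split)
    moreover have "(\<Union>j. A j) \<subseteq> (\<Union>n. cball (c' n) (\<rho>' n))"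
    proof
      fix x assume "x \<in> (\<Union>j. A j)"
      then obtain j i where "x \<in> cball (c j i) (\<rho> j i)" using c(3) by blast
      then have "x \<in> cball (c' (prod_encode (j, i))) (\<rho>' (prod_encode (j, i)))"
        by (simp add: c'_def \<rho>'_def)
      then show "x \<in> (\<Union>n. cball (c' n) (\<rho>' n))" by blast
    qed
    moreover have "(\<Sum>n. ennreal (\<rho>' n ^ k)) \<le> ennreal \<epsilon>"
    proof -
      have "(\<Sum>n. ennreal (\<rho>' n ^ k)) = (\<Sum>j. \<Sum>i. ennreal (\<rho> j i ^ k))"
      proof (rule trans[OF _ suminf_ennreal_2dimen[of "\<lambda>j. \<Sum>i. ennreal (\<rho> j i ^ k)" "\<lambda>(j,i). ennreal (\<rho> j i ^ k)"]])
        show "(\<Sum>n. ennreal (\<rho>' n ^ k)) = (\<Sum>i. case prod_decode i of (j, i) \<Rightarrow> ennreal (\<rho> j i ^ k))"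
          by (intro suminf_cong) (simp add: \<rho>'_def split: prod.split)
      qed auto
      also have "\<dots> \<le> (\<Sum>j. ennreal (\<epsilon> * (1 / 2) ^ Suc j))" by (intro suminf_le c(4) summableI)
      also have "\<dots> = ennreal \<epsilon>"
        using e sums_mult[OF power_half_series, of \<epsilon>] by (intro suminf_ennreal_eq) auto
      finally show ?thesis .
    qed
    ultimately show "\<exists>c \<rho>. (\<forall>i::nat. 0 \<le> \<rho> i \<and> \<rho> i \<le> \<delta>) \<and> (\<Union>j. A j) \<subseteq> (\<Union>i. cball (c i) (\<rho> i)) \<and>
         (\<Sum>i. ennreal (\<rho> i ^ k)) \<le> ennreal \<epsilon>" by blast
  qed
qed

section \<open>Transversal sets and their prisms\<close>

text \<open>
  Every chord of \<open>S\<close> makes an angle of at least 60 degrees with the line spanned by \<open>v\<close>.  Equivalently, \<open>S\<close> is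
  part of the graph of a function over the hyperplane orthogonal to \<open>v\<close> with Lipschitz constant \<open>1 / sqrt 3\<close>.
\<close>

definition transversal :: "'a::real_inner \<Rightarrow> 'a set \<Rightarrow> bool" where
  "transversal v S \<longleftrightarrow> norm v = 1 \<and> (\<forall>x\<in>S. \<forall>y\<in>S. \<bar>v \<bullet> (x - y)\<bar> \<le> norm (x - y) / 2)"

definition prism :: "'a::real_vector \<Rightarrow> 'a set \<Rightarrow> 'a set" where
  "prism v S = (\<lambda>(x, t). x + t *\<^sub>R v) ` (S \<times> {0..1})"

lemma compact_prism:
  fixes K :: "'a::real_normed_vector set"
  assumes "compact K" shows "compact (prism v K)"
  unfolding prism_def
  by (intro compact_continuous_image compact_Times assms compact_Icc)
    (auto intro!: continuous_intros simp: case_prod_unfold)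

lemma transversal_subset: "transversal v S \<Longrightarrow> T \<subseteq> S \<Longrightarrow> transversal v T"
  unfolding transversal_def by blast

lemma transversal_closure:
  fixes S :: "'a::real_inner set"
  assumes "transversal v S" shows "transversal v (closure S)"
  unfolding transversal_def
proof (intro conjI ballI)
  show "norm v = 1" using assms by (simp add: transversal_def)
  fix x y assume "x \<in> closure S" "y \<in> closure S"
  then obtain f g where fg: "\<And>n. f n \<in> S" "f \<longlonglongrightarrow> x" "\<And>n. g n \<in> S" "g \<longlonglongrightarrow> y"
    unfolding closure_sequential by blast
  show "\<bar>v \<bullet> (x - y)\<bar> \<le> norm (x - y) / 2"
  proof (rule LIMSEQ_le)
    show "(\<lambda>n. \<bar>v \<bullet> (f n - g n)\<bar>) \<longlonglongrightarrow> \<bar>v \<bullet> (x - y)\<bar>" by (intro tendsto_intros fg)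
    show "(\<lambda>n. norm (f n - g n) / 2) \<longlonglongrightarrow> norm (x - y) / 2" by (intro tendsto_intros fg) simp
    show "\<exists>N. \<forall>n\<ge>N. \<bar>v \<bullet> (f n - g n)\<bar> \<le> norm (f n - g n) / 2"
      using assms fg unfolding transversal_def by blast
  qed
qed

text \<open>
  The map \<open>(x, t) \<mapsto> x + t *\<^sub>R v\<close> is injective on \<open>S \<times> UNIV\<close> with Lipschitz inverse.  The proof expands the
  squared norm and absorbs the mixed term by the inequality of arithmetic and geometric means.
\<close>

lemma transversal_separation:
  assumes "transversal v S" "x \<in> S" "y \<in> S"
  shows "max (norm (x - y)) \<bar>t - s\<bar> \<le> 2 * norm ((x + t *\<^sub>R v) - (y + s *\<^sub>R v))"
proof -
  define w where "w = x - y"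
  define \<tau> where "\<tau> = t - s"
  have v: "norm v = 1" "\<bar>v \<bullet> w\<bar> \<le> norm w / 2" using assms by (auto simp: transversal_def w_def)
  define X where "X = \<tau> * (v \<bullet> w)"
  have "(norm (w + \<tau> *\<^sub>R v))\<^sup>2 = (norm w)\<^sup>2 + 2 * X + \<tau>\<^sup>2"
    unfolding X_def using v(1) unfolding power2_norm_eq_inner
    by (simp add: inner_commute inner_add norm_eq_1 power2_eq_square algebra_simps)
  moreover have "- X \<le> ((norm w)\<^sup>2 + \<tau>\<^sup>2) / 4"
  proof -
    have "- X \<le> \<bar>\<tau>\<bar> * \<bar>v \<bullet> w\<bar>" unfolding X_def by (metis abs_ge_minus_self abs_mult)
    also have "\<dots> \<le> \<bar>\<tau>\<bar> * (norm w / 2)" by (intro mult_left_mono v) auto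
    also have "\<dots> \<le> ((norm w)\<^sup>2 + \<tau>\<^sup>2) / 4"
      using sum_squares_bound[of "norm w" "\<bar>\<tau>\<bar>"] by (simp add: mult.commute)
    finally show ?thesis .
  qed
  moreover have "A + B \<le> 2 * n" if "n = A + 2 * X + B" "- X \<le> (A + B) / 4" for A B n :: real
    using that by simp
  ultimately have *: "(norm w)\<^sup>2 + \<tau>\<^sup>2 \<le> 2 * (norm (w + \<tau> *\<^sub>R v))\<^sup>2" by blast
  have "A \<le> 4 * n \<and> B \<le> 4 * n" if "A + B \<le> 2 * n" "0 \<le> A" "0 \<le> B" for A B n :: real
    using that by simp
  from this[OF *] have "(norm w)\<^sup>2 \<le> (2 * norm (w + \<tau> *\<^sub>R v))\<^sup>2" "\<bar>\<tau>\<bar>\<^sup>2 \<le> (2 * norm (w + \<tau> *\<^sub>R v))\<^sup>2"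
    by (simp_all add: power_mult_distrib)
  then have "norm w \<le> 2 * norm (w + \<tau> *\<^sub>R v)" "\<bar>\<tau>\<bar> \<le> 2 * norm (w + \<tau> *\<^sub>R v)"
    by (auto intro: power2_le_imp_le)
  moreover have "w + \<tau> *\<^sub>R v = (x + t *\<^sub>R v) - (y + s *\<^sub>R v)" by (simp add: w_def \<tau>_def algebra_simps)
  ultimately show ?thesis by (metis max.bounded_iff w_def \<tau>_def)
qed

text \<open>
  Over each of the separated points of \<open>P\<close>, the segment in direction \<open>v\<close> of length \<open>1\<close> carries \<open>q\<close> disjoint
  balls of radius \<open>\<rho>\<close>.  By transversality, balls over different points are disjoint as well.  Since
  \<open>q\<close> is of order \<open>1 / \<rho>\<close>, this bounds \<open>card P * \<rho> ^ (n - 1)\<close> by a Lebesgue measure, where \<open>n\<close> is the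
  dimension.
\<close>

lemma packing_bound:
  fixes P :: "'a::euclidean_space set"
  assumes tr: "transversal v P" and P: "finite P"
    and sep: "\<And>x y. x \<in> P \<Longrightarrow> y \<in> P \<Longrightarrow> x \<noteq> y \<Longrightarrow> 4 * \<rho> \<le> norm (x - y)"
    and \<rho>: "0 < \<rho>" "4 * \<rho> * real q = 1"
    and V: "V \<in> lmeasurable" "\<And>z. z \<in> prism v P \<Longrightarrow> ball z \<rho> \<subseteq> V"
  shows "real (card P) * (real q * (unit_ball_vol (DIM('a)) * \<rho> ^ DIM('a))) \<le> measure lebesgue V"
proof -
  define z where "z = (\<lambda>(x, j::nat). x + (4 * \<rho> * real j) *\<^sub>R v)"
  let ?I = "P \<times> {..<q}"
  have disj: "ball (z i) \<rho> \<inter> ball (z j) \<rho> = {}" if "i \<in> ?I" "j \<in> ?I" "i \<noteq> j" for i j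
  proof -
    obtain x a y b where ij: "i = (x, a)" "j = (y, b)" by fastforce
    have xy: "x \<in> P" "y \<in> P" using that ij by auto
    have "4 * \<rho> \<le> max (norm (x - y)) \<bar>4 * \<rho> * real a - 4 * \<rho> * real b\<bar>"
    proof (cases "x = y")
      case True
      then have "1 \<le> \<bar>real a - real b\<bar>" using that(3) ij by auto
      then have "4 * \<rho> * 1 \<le> 4 * \<rho> * \<bar>real a - real b\<bar>" using \<rho> by (intro mult_left_mono) auto
      also have "\<dots> = \<bar>4 * \<rho> * real a - 4 * \<rho> * real b\<bar>"
        using \<rho>(1) by (simp add: abs_mult right_diff_distrib[symmetric])
      finally show ?thesis by simp
    qed (use sep xy in \<open>auto simp: le_max_iff_disj\<close>)
    also have "\<dots> \<le> 2 * norm (z i - z j)"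
      unfolding z_def ij split by (rule transversal_separation[OF tr xy])
    finally have "2 * \<rho> \<le> dist (z i) (z j)" by (simp add: dist_norm)
    then show ?thesis by (intro disjoint_ballI) simp
  qed
  have "real (card P) * (real q * (unit_ball_vol (DIM('a)) * \<rho> ^ DIM('a)))
      = (\<Sum>i\<in>?I. measure lebesgue (ball (z i) \<rho>))"
    using \<rho> by (simp add: content_ball measure_completion card_cartesian_product mult.assoc)
  also have "\<dots> = measure lebesgue (\<Union>i\<in>?I. ball (z i) \<rho>)"
    by (rule measure_UNION'[symmetric])
      (use P disj in \<open>auto simp: pairwise_def disjnt_def\<close>)
  also have "\<dots> \<le> measure lebesgue V"
  proof (rule measure_mono_fmeasurable)
    show "(\<Union>i\<in>?I. ball (z i) \<rho>) \<subseteq> V"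
    proof (rule UN_least)
      fix i assume "i \<in> ?I"
      then obtain x j where i: "i = (x, j)" "x \<in> P" "j < q" by auto
      have "4 * \<rho> * real j \<le> 4 * \<rho> * real q" using i \<rho> by (intro mult_left_mono) auto
      then have "z i \<in> prism v P" unfolding prism_def z_def i split using i(2) \<rho>
        by (intro image_eqI[of _ _ "(x, 4 * \<rho> * real j)"]) auto
      then show "ball (z i) \<rho> \<subseteq> V" by (rule V(2))
    qed
  qed (use P V in auto)
  finally show ?thesis .
qed

text \<open>
  A maximal \<open>4 * \<rho>\<close>-separated subset \<open>P\<close> of \<open>K\<close> yields a covering of \<open>K\<close> by balls of radius \<open>4 * \<rho>\<close>.  The packing
  bound, applied to an open neighbourhood of the prism of small measure, makes the sum of the
  \<open>(n - 1)\<close>-th powers of the radii small.  This step goes from Lebesgue measure in dimension \<open>n\<close> to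
  Hausdorff measure in dimension \<open>n - 1\<close> without a measure on hyperplanes.
\<close>

lemma hausdorff_null_if_prism_null:
  fixes K :: "'a::euclidean_space set"
  assumes N: "is_norm N" and eqv: "equivalent_norms N norm" and dim: "DIM('a) \<ge> 2"
    and K: "compact K" and tr: "transversal v K" and null: "negligible (prism v K)"
  shows "hausdorff_measure (\<lambda>x y. N (x - y)) (DIM('a) - 1) K = 0"
proof -
  obtain a b where ab: "a > 0" "b > 0" "\<And>x. a * N x \<le> norm x" "\<And>x. norm x \<le> b * N x"
    using eqv unfolding equivalent_norms_def by blast
  define k where "k = DIM('a) - 1"
  have k: "0 < k" "DIM('a) = Suc k" using dim by (auto simp: k_def)
  define \<omega> where "\<omega> = unit_ball_vol (real (DIM('a)))"
  have \<omega>: "0 < \<omega>" by (simp add: \<omega>_def)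
  show ?thesis unfolding k_def[symmetric]
  proof (rule hausdorff_null_if_ball_covers[OF N ab(3,1) k(1)])
    fix \<epsilon> \<delta> :: real assume e: "0 < \<epsilon>" "0 < \<delta>"
    define \<epsilon>' where "\<epsilon>' = \<epsilon> * \<omega> / 4 ^ Suc k"
    have e': "0 < \<epsilon>'" using e \<omega> by (simp add: \<epsilon>'_def)
    have pm: "prism v K \<in> lmeasurable" by (intro lmeasurable_compact compact_prism K)
    obtain V where V: "open V" "prism v K \<subseteq> V" "V \<in> lmeasurable" "measure lebesgue V < \<epsilon>'"
    proof -
      obtain V where V: "open V" "prism v K \<subseteq> V" "V - prism v K \<in> lmeasurable" "emeasure lebesgue (V - prism v K) < ennreal \<epsilon>'"
        using sets_lebesgue_outer_open[OF fmeasurableD[OF pm] e'] by blast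
      have Veq: "V = prism v K \<union> (V - prism v K)" using V by auto
      have "V \<in> lmeasurable" by (subst Veq) (intro fmeasurable.Un pm V)
      moreover have "measure lebesgue V \<le> measure lebesgue (prism v K) + measure lebesgue (V - prism v K)"
        by (subst Veq, rule measure_Un_le) (use pm V in auto)
      moreover have "measure lebesgue (prism v K) = 0" using null by (rule negligible_imp_measure0)
      moreover have "measure lebesgue (V - prism v K) < \<epsilon>'"
        using V(3,4) e' by (simp add: emeasure_eq_measure2 ennreal_less_iff)
      ultimately show ?thesis using V(1,2) that by simp
    qed
    obtain \<delta>\<^sub>1 where d1: "0 < \<delta>\<^sub>1" "(\<Union>x\<in>prism v K. ball x \<delta>\<^sub>1) \<subseteq> V"
      using compact_subset_open_imp_ball_epsilon_subset[OF compact_prism[OF K] V(1,2)] by blast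
    \<comment> \<open>\<open>\<rho>\<close> is chosen of the form \<open>1 / (4 * q)\<close> so that \<open>q\<close> steps of length \<open>4 * \<rho>\<close> fill the segment exactly\<close>
    obtain q0 where q0: "inverse (real (Suc q0)) < min \<delta>\<^sub>1 \<delta>" using reals_Archimedean[of "min \<delta>\<^sub>1 \<delta>"] d1 e by auto
    define q where "q = Suc q0"
    define \<rho> where "\<rho> = 1 / (4 * real q)"
    have q: "0 < real q" by (simp add: q_def)
    have \<rho>: "0 < \<rho>" "4 * \<rho> * real q = 1" "\<rho> \<le> \<delta>\<^sub>1" "4 * \<rho> \<le> \<delta>"
      using q q0 unfolding \<rho>_def q_def by (auto simp: field_simps)
    define good where "good P \<longleftrightarrow> finite P \<and> P \<subseteq> K \<and> (\<forall>x\<in>P. \<forall>y\<in>P. x \<noteq> y \<longrightarrow> 4 * \<rho> \<le> norm (x - y))" for P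
    have bound: "real (card P) * (real q * (\<omega> * \<rho> ^ DIM('a))) \<le> measure lebesgue V" if "good P" for P
      unfolding \<omega>_def
    proof (rule packing_bound[of v])
      show "transversal v P" using tr that unfolding good_def by (blast intro: transversal_subset)
      fix z assume "z \<in> prism v P"
      then have "z \<in> prism v K" using that unfolding good_def prism_def by auto
      then show "ball z \<rho> \<subseteq> V" using d1(2) \<rho>(3) subset_ball[OF \<rho>(3), of z] by blast
    qed (use that V \<rho> in \<open>auto simp: good_def\<close>)
    define c0 where "c0 = real q * (\<omega> * \<rho> ^ DIM('a))"
    have c0: "0 < c0" using q \<omega> \<rho> by (simp add: c0_def)
    \<comment> \<open>the packing bound itself shows that separated sets have bounded cardinality\<close>
    have "\<exists>P. good P \<and> (\<forall>P'. good P' \<longrightarrow> card P' \<le> card P)"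
    proof (rule ex_has_greatest_nat[of good "{}" card "Suc (nat \<lceil>measure lebesgue V / c0\<rceil>)"])
      show "\<forall>P. good P \<longrightarrow> card P < Suc (nat \<lceil>measure lebesgue V / c0\<rceil>)"
      proof (intro allI impI)
        fix P assume "good P"
        then have "real (card P) \<le> measure lebesgue V / c0"
          using bound[of P] c0 unfolding c0_def[symmetric] by (simp add: field_simps)
        then show "card P < Suc (nat \<lceil>measure lebesgue V / c0\<rceil>)" by linarith
      qed
    qed (simp add: good_def)
    then obtain P where P: "good P" "\<And>P'. good P' \<Longrightarrow> card P' \<le> card P" by blast
    have cov: "K \<subseteq> (\<Union>x\<in>P. cball x (4 * \<rho>))"
    proof
      fix y assume y: "y \<in> K"
      show "y \<in> (\<Union>x\<in>P. cball x (4 * \<rho>))"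
      proof (rule ccontr)
        assume "y \<notin> (\<Union>x\<in>P. cball x (4 * \<rho>))"
        then have far: "\<And>x. x \<in> P \<Longrightarrow> 4 * \<rho> < norm (x - y)" by (auto simp: dist_norm)
        then have "y \<notin> P" using \<rho>(1) by fastforce
        moreover have "good (insert y P)"
          using P(1) y far unfolding good_def by (auto simp: norm_minus_commute less_imp_le)
        ultimately show False using P(2)[of "insert y P"] P(1) by (simp add: good_def)
      qed
    qed
    have fin: "finite P" using P(1) by (simp add: good_def)
    obtain h where h: "bij_betw h {0..<card P} P" using ex_bij_betw_nat_finite[OF fin] by blast
    define r where "r i = (if i < card P then 4 * \<rho> else 0)" for i
    have "\<forall>i. 0 \<le> r i \<and> r i \<le> \<delta>" using \<rho> e by (auto simp: r_def)
    moreover have "K \<subseteq> (\<Union>i. cball (h i) (r i))"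
    proof
      fix y assume "y \<in> K"
      then obtain x where x: "x \<in> P" "y \<in> cball x (4 * \<rho>)" using cov by blast
      then have "x \<in> h ` {0..<card P}" using h by (simp add: bij_betw_def)
      then obtain i where "i < card P" "x = h i" by auto
      then show "y \<in> (\<Union>i. cball (h i) (r i))" using x(2) by (auto simp: r_def intro!: exI[of _ i])
    qed
    moreover have "(\<Sum>i. ennreal (r i ^ k)) \<le> ennreal \<epsilon>"
    proof -
      have "(\<Sum>i. ennreal (r i ^ k)) = (\<Sum>i<card P. ennreal (r i ^ k))"
        using k(1) by (intro suminf_finite) (auto simp: r_def)
      also have "\<dots> = (\<Sum>i<card P. ennreal ((4 * \<rho>) ^ k))" by (intro sum.cong) (auto simp: r_def)
      also have "\<dots> = ennreal (real (card P) * (4 * \<rho>) ^ k)"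
        using \<rho>(1) by (subst sum_ennreal) auto
      also have "real (card P) * (4 * \<rho>) ^ k \<le> \<epsilon>"
      proof -
        have h1: "real q * \<rho> = 1 / 4" using \<rho>(2) by (simp add: mult_ac)
        have h2: "real q * (\<omega> * \<rho> ^ DIM('a)) = (real q * \<rho>) * (\<omega> * \<rho> ^ k)"
          unfolding k(2) by (simp add: mult_ac)
        have "real q * (\<omega> * \<rho> ^ DIM('a)) = \<omega> * \<rho> ^ k / 4" unfolding h2 h1 by simp
        from bound[OF P(1), unfolded this] have "real (card P) * (\<omega> * \<rho> ^ k / 4) \<le> \<epsilon>'"
          using V(4) by linarith
        then have "real (card P) * (\<omega> * \<rho> ^ k / 4) * (4 ^ Suc k / \<omega>) \<le> \<epsilon>' * (4 ^ Suc k / \<omega>)"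
          using \<omega> by (intro mult_right_mono) auto
        then show ?thesis using \<omega> by (simp add: \<epsilon>'_def power_mult_distrib mult_ac)
      qed
      finally show ?thesis by (simp add: ennreal_leI)
    qed
    ultimately show "\<exists>c \<rho>. (\<forall>i::nat. 0 \<le> \<rho> i \<and> \<rho> i \<le> \<delta>) \<and> K \<subseteq> (\<Union>i. cball (c i) (\<rho> i)) \<and>
         (\<Sum>i. ennreal (\<rho> i ^ k)) \<le> ennreal \<epsilon>" by blast
  qed
qed

lemma countable_nonnull_disjoint:
  fixes A :: "'i \<Rightarrow> 'a::euclidean_space set"
  assumes T: "T \<in> lmeasurable" and A: "\<And>i. A i \<in> lmeasurable" "\<And>i. A i \<subseteq> T"
    and disj: "\<And>i j. i \<noteq> j \<Longrightarrow> A i \<inter> A j = {}"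
  shows "countable {i. \<not> negligible (A i)}"
proof -
  have "finite {i. 1 / real (Suc m) < measure lebesgue (A i)}" for m
  proof (rule ccontr)
    assume "infinite {i. 1 / real (Suc m) < measure lebesgue (A i)}"
    then obtain J where J: "finite J" "card J = nat \<lceil>measure lebesgue T * real (Suc m)\<rceil> + 1"
      "J \<subseteq> {i. 1 / real (Suc m) < measure lebesgue (A i)}"
      using infinite_arbitrarily_large by metis
    have "real (card J) * (1 / real (Suc m)) = (\<Sum>i\<in>J. 1 / real (Suc m))" by simp
    also have "\<dots> \<le> (\<Sum>i\<in>J. measure lebesgue (A i))" using J(3) by (intro sum_mono) auto
    also have "\<dots> = measure lebesgue (\<Union>i\<in>J. A i)"
      by (rule measure_UNION'[symmetric]) (use J A disj in \<open>auto simp: pairwise_def disjnt_def\<close>)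
    also have "\<dots> \<le> measure lebesgue T"
      using J A T by (intro measure_mono_fmeasurable) auto
    finally have "real (card J) \<le> measure lebesgue T * real (Suc m)" by (simp add: field_simps)
    then show False using J(2) by linarith
  qed
  then have "countable (\<Union>m. {i. 1 / real (Suc m) < measure lebesgue (A i)})"
    by (intro countable_UN) (auto intro: countable_finite)
  moreover have "{i. \<not> negligible (A i)} \<subseteq> (\<Union>m. {i. 1 / real (Suc m) < measure lebesgue (A i)})"
  proof
    fix i assume "i \<in> {i. \<not> negligible (A i)}"
    then have "0 < measure lebesgue (A i)"
      using A(1)[of i] measure_nonneg[of lebesgue "A i"] by (auto simp: negligible_iff_measure order_less_le)
    then obtain m where "inverse (real (Suc m)) < measure lebesgue (A i)" using reals_Archimedean by blast
    then show "i \<in> (\<Union>m. {i. 1 / real (Suc m) < measure lebesgue (A i)})"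
      by (auto simp: inverse_eq_divide)
  qed
  ultimately show ?thesis by (rule countable_subset[rotated])
qed

text \<open>
  Different levels sweep out disjoint prisms, all inside the prism of \<open>K\<close>, which has finite measure.
\<close>

lemma countable_nonnull_levels:
  fixes K :: "'a::euclidean_space set"
  assumes N: "is_norm N" and eqv: "equivalent_norms N norm" and dim: "DIM('a) \<ge> 2"
    and K: "compact K" and tr: "transversal v K" and g: "continuous_on K g"
  shows "countable {r::real. hausdorff_measure (\<lambda>x y. N (x - y)) (DIM('a) - 1) {x \<in> K. g x = r} \<noteq> 0}"
proof -
  have cK: "compact {x \<in> K. g x = r}" for r
  proof -
    have "closedin (top_of_set K) {x \<in> K. g x = r}"
      by (rule continuous_closedin_preimage_constant[OF g])
    then show ?thesis using K closedin_compact by blast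
  qed
  have "countable {r. \<not> negligible (prism v {x \<in> K. g x = r})}"
  proof (rule countable_nonnull_disjoint[of "prism v K"])
    fix r s :: real assume rs: "r \<noteq> s"
    show "prism v {x \<in> K. g x = r} \<inter> prism v {x \<in> K. g x = s} = {}"
    proof (rule ccontr)
      assume "prism v {x \<in> K. g x = r} \<inter> prism v {x \<in> K. g x = s} \<noteq> {}"
      then obtain x y t u where xy: "x \<in> K" "g x = r" "y \<in> K" "g y = s" "x + t *\<^sub>R v = y + u *\<^sub>R v"
        unfolding prism_def by auto
      have "max (norm (x - y)) \<bar>t - u\<bar> \<le> 0"
        using transversal_separation[OF tr xy(1,3), of t u] xy(5) by simp
      then show False using xy rs by simp
    qed
  next
    fix r show "prism v {x \<in> K. g x = r} \<subseteq> prism v K" by (auto simp: prism_def)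
  qed (intro lmeasurable_compact compact_prism K cK)+
  moreover have "{r. hausdorff_measure (\<lambda>x y. N (x - y)) (DIM('a) - 1) {x \<in> K. g x = r} \<noteq> 0}
      \<subseteq> {r. \<not> negligible (prism v {x \<in> K. g x = r})}"
  proof clarify
    fix r assume nz: "hausdorff_measure (\<lambda>x y. N (x - y)) (DIM('a) - 1) {x \<in> K. g x = r} \<noteq> 0"
      and neg: "negligible (prism v {x \<in> K. g x = r})"
    have "transversal v {x \<in> K. g x = r}" by (rule transversal_subset[OF tr]) auto
    from hausdorff_null_if_prism_null[OF N eqv dim cK this neg] nz show False by simp
  qed
  ultimately show ?thesis by (rule countable_subset[rotated])
qed

section \<open>Level sets that separate a ball\<close>

text \<open>
  A ball of radius \<open>\<rho>\<close> swept along the vector \<open>w\<close> has measure of order \<open>\<rho> ^ (n - 1)\<close>, because about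
  \<open>norm w / \<rho>\<close> balls of radius \<open>2 * \<rho>\<close> cover it.
\<close>

lemma tube_measure_le:
  fixes s w :: "'a::euclidean_space"
  assumes \<rho>: "0 < \<rho>" "\<rho> \<le> 1" and n: "DIM('a) = Suc k"
  obtains T where "T \<in> sets lebesgue" "(\<lambda>(x, t). x - t *\<^sub>R w) ` (cball s \<rho> \<times> {0..1}) \<subseteq> T"
    "emeasure lebesgue T \<le> ennreal ((norm w + 2) * unit_ball_vol (DIM('a)) * 2 ^ DIM('a)) * ennreal (\<rho> ^ k)"
proof -
  define q where "q = nat \<lceil>norm w / \<rho>\<rceil>"
  have q: "norm w / \<rho> \<le> real q" "real q \<le> norm w / \<rho> + 1"
    using \<rho> by (auto simp: q_def of_nat_ceiling)
  define T where "T = (\<Union>j\<in>{..q}. cball (s - (real j / real q) *\<^sub>R w) (2 * \<rho>))"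
  have "T \<in> sets lebesgue" unfolding T_def by (intro sets.finite_UN) auto
  moreover have "(\<lambda>(x, t). x - t *\<^sub>R w) ` (cball s \<rho> \<times> {0..1}) \<subseteq> T"
  proof clarify
    fix x t assume xt: "x \<in> cball s \<rho>" "t \<in> {0..1::real}"
    define j where "j = nat \<lfloor>t * real q\<rfloor>"
    have tq: "0 \<le> t * real q" "t * real q \<le> real q" using xt(2) by (auto intro: mult_left_le_one_le)
    have j: "real j \<le> t * real q" "t * real q < real j + 1" using tq unfolding j_def by linarith+
    have "j \<le> q" using j tq by linarith
    moreover have "x - t *\<^sub>R w \<in> cball (s - (real j / real q) *\<^sub>R w) (2 * \<rho>)"
    proof -
      have "norm ((t - real j / real q) *\<^sub>R w) \<le> \<rho>"
      proof (cases "q = 0")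
        case True
        then have "norm w / \<rho> \<le> 0" using q(1) by simp
        then have "w = 0" using \<rho>(1) by (simp add: divide_le_0_iff)
        then show ?thesis using \<rho> by simp
      next
        case False
        then have "t - real j / real q = (t * real q - real j) / real q" by (simp add: field_simps)
        then have "\<bar>t - real j / real q\<bar> \<le> 1 / real q" using j by (simp add: divide_right_mono)
        then have "\<bar>t - real j / real q\<bar> * norm w \<le> 1 / real q * norm w" by (intro mult_right_mono) auto
        also have "\<dots> \<le> \<rho>" using q(1) \<rho>(1) False by (simp add: field_simps)
        finally show ?thesis by simp
      qed
      moreover have "norm (x - s) \<le> \<rho>" using xt(1) by (simp add: dist_norm norm_minus_commute)
      moreover have "norm ((x - t *\<^sub>R w) - (s - (real j / real q) *\<^sub>R w)) \<le> norm (x - s) + norm ((t - real j / real q) *\<^sub>R w)"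
        using norm_triangle_ineq4[of "x - s" "(t - real j / real q) *\<^sub>R w"] by (simp add: algebra_simps)
      ultimately show ?thesis by (simp add: dist_norm norm_minus_commute)
    qed
    ultimately show "x - t *\<^sub>R w \<in> T" unfolding T_def by blast
  qed
  moreover have "emeasure lebesgue T \<le> ennreal ((norm w + 2) * unit_ball_vol (DIM('a)) * 2 ^ DIM('a)) * ennreal (\<rho> ^ k)"
  proof -
    let ?c = "unit_ball_vol (DIM('a))"
    have "emeasure lebesgue T \<le> (\<Sum>j\<in>{..q}. emeasure lebesgue (cball (s - (real j / real q) *\<^sub>R w) (2 * \<rho>)))"
      unfolding T_def by (rule emeasure_subadditive_finite) auto
    also have "\<dots> = (\<Sum>j\<in>{..q}. ennreal (?c * (2 * \<rho>) ^ DIM('a)))"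
      using \<rho> by (simp add: emeasure_completion emeasure_cball)
    also have "\<dots> = ennreal ((real q + 1) * (?c * (2 * \<rho>) ^ DIM('a)))"
      using \<rho> by (subst sum_ennreal) (auto simp: algebra_simps)
    also have "\<dots> \<le> ennreal (((norm w + 2) * ?c * 2 ^ DIM('a)) * \<rho> ^ k)"
    proof (rule ennreal_leI)
      have "(real q + 1) * \<rho> \<le> (norm w / \<rho> + 2) * \<rho>" using q \<rho> by (intro mult_right_mono) auto
      also have "\<dots> \<le> norm w + 2" using \<rho> by (simp add: field_simps)
      finally have "((real q + 1) * \<rho>) * (?c * 2 ^ DIM('a) * \<rho> ^ k) \<le> (norm w + 2) * (?c * 2 ^ DIM('a) * \<rho> ^ k)"
        using \<rho> by (intro mult_right_mono) auto
      then show "(real q + 1) * (?c * (2 * \<rho>) ^ DIM('a)) \<le> ((norm w + 2) * ?c * 2 ^ DIM('a)) * \<rho> ^ k"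
        unfolding n power_mult_distrib by (simp add: mult_ac)
    qed
    also have "\<dots> = ennreal ((norm w + 2) * ?c * 2 ^ DIM('a)) * ennreal (\<rho> ^ k)"
      using \<rho> by (intro ennreal_mult) auto
    finally show ?thesis .
  qed
  ultimately show thesis by (rule that)
qed

text \<open>
  If \<open>S\<close> meets every translate of the segment from \<open>0\<close> to \<open>w\<close> that starts in a ball, then sweeping \<open>S\<close> back along
  \<open>w\<close> covers that ball.  A covering of a null set \<open>S\<close> by small balls would sweep out arbitrarily small
  measure.
\<close>

lemma separating_set_not_hausdorff_null:
  fixes S :: "'a::euclidean_space set"
  assumes N: "is_norm N" and eqv: "equivalent_norms N norm" and dim: "DIM('a) \<ge> 2"
    and e: "0 < e" and cross: "\<And>x. x \<in> ball a e \<Longrightarrow> \<exists>t\<in>{0..1}. x + t *\<^sub>R w \<in> S"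
  shows "hausdorff_measure (\<lambda>x y. N (x - y)) (DIM('a) - 1) S \<noteq> 0"
proof
  assume null: "hausdorff_measure (\<lambda>x y. N (x - y)) (DIM('a) - 1) S = 0"
  obtain b where ab: "b > 0" "\<And>x. norm x \<le> b * N x"
    using eqv unfolding equivalent_norms_def by blast
  define k where "k = DIM('a) - 1"
  have k: "0 < k" "DIM('a) = Suc k" using dim by (auto simp: k_def)
  define K where "K = (norm w + 2) * unit_ball_vol (DIM('a)) * 2 ^ DIM('a)"
  have K: "0 < K" by (auto simp: K_def intro!: mult_pos_pos add_nonneg_pos)
  define \<mu> where "\<mu> = unit_ball_vol (DIM('a)) * e ^ DIM('a)"
  have \<mu>: "0 < \<mu>" using e by (simp add: \<mu>_def)
  obtain c :: "nat \<Rightarrow> 'a" and \<rho> where c: "\<And>i. 0 < \<rho> i" "\<And>i. \<rho> i \<le> 1"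
    "S \<subseteq> (\<Union>i. cball (c i) (\<rho> i))" "(\<Sum>i. ennreal (\<rho> i ^ k)) \<le> ennreal (\<mu> / (2 * K))"
    by (rule ball_cover_if_hausdorff_null[OF N ab(2,1) k(1) null[folded k_def], of "\<mu> / (2 * K)" 1])
      (use \<mu> K in auto)
  define Q where "Q i T \<longleftrightarrow> T \<in> sets lebesgue \<and> (\<lambda>(x, t). x - t *\<^sub>R w) ` (cball (c i) (\<rho> i) \<times> {0..1}) \<subseteq> T \<and>
     emeasure lebesgue T \<le> ennreal K * ennreal (\<rho> i ^ k)" for i T
  have "\<exists>T. Q i T" for i
    unfolding K_def Q_def
    by (rule tube_measure_le[OF c(1)[of i] c(2)[of i] k(2), where s = "c i" and w = w]) blast
  then obtain T where "\<And>i. Q i (T i)" by metis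
  then have T: "\<And>i. T i \<in> sets lebesgue"
    "\<And>i. (\<lambda>(x, t). x - t *\<^sub>R w) ` (cball (c i) (\<rho> i) \<times> {0..1}) \<subseteq> T i"
    "\<And>i. emeasure lebesgue (T i) \<le> ennreal K * ennreal (\<rho> i ^ k)" unfolding Q_def by blast+
  have "ball a e \<subseteq> (\<Union>i. T i)"
  proof
    fix x assume "x \<in> ball a e"
    then obtain t where t: "t \<in> {0..1}" "x + t *\<^sub>R w \<in> S" using cross by blast
    then obtain i where i: "x + t *\<^sub>R w \<in> cball (c i) (\<rho> i)" using c(3) by blast
    have "x \<in> (\<lambda>(x, t). x - t *\<^sub>R w) ` (cball (c i) (\<rho> i) \<times> {0..1})"
      using i t(1) by (intro image_eqI[of _ _ "(x + t *\<^sub>R w, t)"]) auto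
    then show "x \<in> (\<Union>i. T i)" using T(2) by blast
  qed
  then have "emeasure lebesgue (ball a e) \<le> emeasure lebesgue (\<Union>i. T i)"
    using T(1) by (intro emeasure_mono) auto
  also have "\<dots> \<le> (\<Sum>i. emeasure lebesgue (T i))"
    using T(1) by (intro emeasure_subadditive_countably) auto
  also have "\<dots> \<le> (\<Sum>i. ennreal K * ennreal (\<rho> i ^ k))" by (intro suminf_le T(3) summableI)
  also have "\<dots> = ennreal K * (\<Sum>i. ennreal (\<rho> i ^ k))" by (rule ennreal_suminf_cmult)
  also have "\<dots> \<le> ennreal K * ennreal (\<mu> / (2 * K))" by (intro mult_left_mono c(4)) auto
  also have "\<dots> = ennreal (\<mu> / 2)" using K \<mu> by (simp add: ennreal_mult[symmetric])
  finally have "emeasure lebesgue (ball a e) \<le> ennreal (\<mu> / 2)" .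
  moreover have "emeasure lebesgue (ball a e) = ennreal \<mu>"
    using e by (simp add: emeasure_completion emeasure_ball \<mu>_def)
  ultimately show False using \<mu> by simp
qed

text \<open>
  Translating a small ball around \<open>a\<close> by \<open>b - a\<close> leads from values below \<open>r\<close> to values above \<open>r\<close>, so by the
  intermediate value theorem the level set meets every connecting segment.
\<close>

lemma level_set_not_hausdorff_null:
  fixes f :: "'a::euclidean_space \<Rightarrow> real"
  assumes N: "is_norm N" and eqv: "equivalent_norms N norm" and dim: "DIM('a) \<ge> 2"
    and B: "open B" "convex B" and f: "continuous_on B f"
    and ab: "a \<in> B" "f a < r" "b \<in> B" "r < f b"
  shows "hausdorff_measure (\<lambda>x y. N (x - y)) (DIM('a) - 1) (B \<inter> {x. f x = r}) \<noteq> 0"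
proof -
  have "open (B \<inter> f -` {..<r})" "open (B \<inter> f -` {r<..})"
    using f B by (auto intro: continuous_open_preimage)
  moreover have "a \<in> B \<inter> f -` {..<r}" "b \<in> B \<inter> f -` {r<..}" using ab by auto
  ultimately obtain e1 e2 where e: "0 < e1" "ball a e1 \<subseteq> B \<inter> f -` {..<r}" "0 < e2" "ball b e2 \<subseteq> B \<inter> f -` {r<..}"
    by (meson openE)
  define e where "e = min e1 e2"
  show ?thesis
  proof (rule separating_set_not_hausdorff_null[OF N eqv dim, of e a "b - a"])
    show "0 < e" using e by (simp add: e_def)
    fix x assume x: "x \<in> ball a e"
    have x1: "x \<in> B" "f x < r" using x e(2) by (auto simp: e_def)
    have "x + (b - a) \<in> ball b e2" using x by (simp add: e_def dist_norm algebra_simps)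
    then have x2: "x + (b - a) \<in> B" "r < f (x + (b - a))" using e(4) by auto
    have inB: "x + t *\<^sub>R (b - a) \<in> B" if "t \<in> {0..1}" for t
    proof -
      have "x + t *\<^sub>R (b - a) = (1 - t) *\<^sub>R x + t *\<^sub>R (x + (b - a))" by (simp add: algebra_simps)
      then show ?thesis using convexD_alt[OF B(2) x1(1) x2(1), of t] that by simp
    qed
    have "continuous_on {0..1} (\<lambda>t. f (x + t *\<^sub>R (b - a)))"
      by (intro continuous_on_compose2[OF f] continuous_intros) (use inB in auto)
    then obtain t where "0 \<le> t" "t \<le> 1" "f (x + t *\<^sub>R (b - a)) = r"
      using IVT'[of "\<lambda>t. f (x + t *\<^sub>R (b - a))" 0 r 1] x1 x2 by auto
    then show "\<exists>t\<in>{0..1}. x + t *\<^sub>R (b - a) \<in> B \<inter> {x. f x = r}" using inB by auto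
  qed
qed

text \<open>
  Each such value is the greatest value of \<open>f\<close> on some member of a countable basis.
\<close>

lemma countable_local_max_values:
  fixes f :: "'a::second_countable_topology \<Rightarrow> 'b::order"
  shows "countable {r. \<exists>x U. f x = r \<and> open U \<and> x \<in> U \<and> (\<forall>y\<in>U. f y \<le> r)}"
proof -
  obtain \<B> :: "'a set set" where \<B>: "countable \<B>" "topological_basis \<B>" using ex_countable_basis by blast
  have "{r. \<exists>x U. f x = r \<and> open U \<and> x \<in> U \<and> (\<forall>y\<in>U. f y \<le> r)} \<subseteq> (\<lambda>B. (GREATEST r. r \<in> f ` B)) ` \<B>"
  proof clarify
    fix x U assume U: "open U" "x \<in> U" "\<forall>y\<in>U. f y \<le> f x"
    then obtain B where B: "B \<in> \<B>" "x \<in> B" "B \<subseteq> U" using topological_basisE[OF \<B>(2)] by metis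
    have "(GREATEST r. r \<in> f ` B) = f x" using U(3) B by (intro Greatest_equality) auto
    then show "f x \<in> (\<lambda>B. (GREATEST r. r \<in> f ` B)) ` \<B>" using B(1) by force
  qed
  then show ?thesis by (rule countable_subset) (intro countable_image \<B>(1))
qed

section \<open>Supergradients of the distance function\<close>

text \<open>
  \<open>C\<close> and \<open>U\<close> are explicit because the arguments below need one constant for all points of a region.
  For fixed \<open>z\<close> the inequality is affine in \<open>p\<close>, so the supergradients at a point form a closed convex set.
\<close>

definition supergradient :: "'a::real_inner set \<Rightarrow> real \<Rightarrow> ('a \<Rightarrow> real) \<Rightarrow> 'a \<Rightarrow> 'a \<Rightarrow> bool" where
  "supergradient U C f z p \<longleftrightarrow> (\<forall>w\<in>U. f w \<le> f z + p \<bullet> (w - z) + C * (norm (w - z))\<^sup>2)"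

text \<open>
  Representing the derivative of \<open>N\<close> by its gradient \<open>D\<close> for the inner product makes its values vectors of the
  space itself, which can be compared by angle and length with differences of points.
\<close>

locale smooth_norm =
  fixes N :: "'a::euclidean_space \<Rightarrow> real" and a b L :: real and D :: "'a \<Rightarrow> 'a"
  assumes N: "is_norm N" and a: "0 < a" "\<And>x. a * N x \<le> norm x"
    and b: "0 < b" "\<And>x. norm x \<le> b * N x"
    and D: "\<And>x. x \<noteq> 0 \<Longrightarrow> (N has_derivative (\<lambda>h. D x \<bullet> h)) (at x)"
    and D_scale: "\<And>x c. x \<noteq> 0 \<Longrightarrow> 0 < c \<Longrightarrow> D (c *\<^sub>R x) = D x"
    and D_lip: "\<And>x y. N x = 1 \<Longrightarrow> N y = 1 \<Longrightarrow> norm (D x - D y) \<le> L * norm (x - y)"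
    and L: "0 \<le> L"

text \<open>
  The derivative is given on the unit sphere only.  Since \<open>N\<close> is positively homogeneous, it is
  differentiable at every \<open>x \<noteq> 0\<close>, with the same gradient as at \<open>x / N x\<close>.  To bound the Euclidean length of a
  difference of gradients \<open>p\<close>, the dual norm is tested on the vector \<open>p\<close> itself.
\<close>

lemma smooth_norm_exists:
  fixes N :: "'a::euclidean_space \<Rightarrow> real"
  assumes N: "is_norm N" and d: "norm_deriv_lipschitz_on_sphere N" and eqv: "equivalent_norms N norm"
  obtains a b L D where "smooth_norm N a b L D"
proof -
  obtain a b where a: "0 < a" "\<And>x. a * N x \<le> norm x" and b: "0 < b" "\<And>x. norm x \<le> b * N x"
    using eqv unfolding equivalent_norms_def by blast
  obtain L where dif: "\<And>x. N x = 1 \<Longrightarrow> N differentiable (at x)" and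
    L: "\<And>x y. N x = 1 \<Longrightarrow> N y = 1 \<Longrightarrow>
        dual_norm N (\<lambda>h. frechet_derivative N (at x) h - frechet_derivative N (at y) h) \<le> L * N (x - y)"
    using d unfolding norm_deriv_lipschitz_on_sphere_def by blast
  define G where "G x = (SOME p. frechet_derivative N (at x) = (\<lambda>h. p \<bullet> h))" for x
  have G2: "frechet_derivative N (at x) = (\<lambda>h. G x \<bullet> h)" and G1: "(N has_derivative (\<lambda>h. G x \<bullet> h)) (at x)"
    if "N x = 1" for x
  proof -
    have fd: "(N has_derivative frechet_derivative N (at x)) (at x)"
      using dif[OF that] frechet_derivative_works by blast
    have "linear (frechet_derivative N (at x))" using has_derivative_linear[OF fd] .
    then have "frechet_derivative N (at x) h = adjoint (frechet_derivative N (at x)) 1 \<bullet> h" for h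
      using adjoint_works[of "frechet_derivative N (at x)" h 1] by (simp add: inner_commute)
    then have "frechet_derivative N (at x) = (\<lambda>h. adjoint (frechet_derivative N (at x)) 1 \<bullet> h)" by blast
    then show *: "frechet_derivative N (at x) = (\<lambda>h. G x \<bullet> h)"
      unfolding G_def by (rule someI)
    show "(N has_derivative (\<lambda>h. G x \<bullet> h)) (at x)" using fd unfolding * .
  qed
  define D where "D x = G ((1 / N x) *\<^sub>R x)" for x
  have pos: "0 < N x" if "x \<noteq> 0" for x
    using is_normD(1,2)[OF N, of x] that by (simp add: order_less_le)
  have unit: "N ((1 / N x) *\<^sub>R x) = 1" if "x \<noteq> 0" for x
    using is_normD(3)[OF N, of "1 / N x" x] pos[OF that] by simp
  have D1: "(N has_derivative (\<lambda>h. D x \<bullet> h)) (at x)" if x: "x \<noteq> 0" for x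
  proof -
    define c where "c = N x"
    have c: "0 < c" using pos[OF x] by (simp add: c_def)
    have "((\<lambda>y. (1 / c) *\<^sub>R y) has_derivative (\<lambda>h. (1 / c) *\<^sub>R h)) (at x)"
      by (intro derivative_eq_intros) auto
    from has_derivative_compose[OF this G1[OF unit[OF x], folded c_def]]
    have "((\<lambda>y. N ((1 / c) *\<^sub>R y)) has_derivative (\<lambda>h. D x \<bullet> ((1 / c) *\<^sub>R h))) (at x)"
      by (simp add: D_def c_def)
    then have "((\<lambda>y. c * N ((1 / c) *\<^sub>R y)) has_derivative (\<lambda>h. c * (D x \<bullet> ((1 / c) *\<^sub>R h)))) (at x)"
      by (rule has_derivative_mult_right)
    moreover have "(\<lambda>y. c * N ((1 / c) *\<^sub>R y)) = N"
    proof
      fix y show "c * N ((1 / c) *\<^sub>R y) = N y" using c by (simp add: is_normD(3)[OF N])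
    qed
    ultimately show ?thesis using c by simp
  qed
  have D2: "D (c *\<^sub>R x) = D x" if "x \<noteq> 0" "0 < c" for x c
    using that by (simp add: D_def is_normD(3)[OF N])
  have D3: "norm (D x - D y) \<le> (\<bar>L\<bar> / (a * a)) * norm (x - y)" if xy: "N x = 1" "N y = 1" for x y
  proof (cases "D x = D y")
    case True
    then show ?thesis using a by simp
  next
    case False
    define p where "p = D x - D y"
    have p: "p = G x - G y" "p \<noteq> 0" using xy False by (simp_all add: p_def D_def)
    have le: "\<bar>p \<bullet> h\<bar> / N h \<le> norm p * b" for h
    proof (cases "h = 0")
      case h: False
      have "\<bar>p \<bullet> h\<bar> \<le> norm p * norm h" by (rule Cauchy_Schwarz_ineq2)
      also have "\<dots> \<le> norm p * (b * N h)" by (intro mult_left_mono b) auto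
      finally show ?thesis using pos[OF h] by (simp add: field_simps)
    qed (use b in auto)
    have "(norm p)\<^sup>2 / N p = \<bar>p \<bullet> p\<bar> / N p" by (simp add: power2_norm_eq_inner)
    also have "\<dots> \<le> dual_norm N (\<lambda>h. p \<bullet> h)"
      unfolding dual_norm_def by (intro cSUP_upper bdd_aboveI2[OF le]) simp
    also have "(\<lambda>h. p \<bullet> h) = (\<lambda>h. frechet_derivative N (at x) h - frechet_derivative N (at y) h)"
      unfolding G2[OF xy(1)] G2[OF xy(2)] p(1) inner_diff_left ..
    also have "dual_norm N \<dots> \<le> L * N (x - y)" by (rule L[OF xy])
    also have "\<dots> \<le> \<bar>L\<bar> * (norm (x - y) / a)"
      using a is_normD(1)[OF N, of "x - y"] a(2)[of "x - y"] by (intro mult_mono) (auto simp: field_simps)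
    finally have "(norm p)\<^sup>2 \<le> \<bar>L\<bar> * (norm (x - y) / a) * N p" using pos[OF p(2)] by (simp add: field_simps)
    also have "\<dots> \<le> \<bar>L\<bar> * (norm (x - y) / a) * (norm p / a)"
      using a a(2)[of p] by (intro mult_left_mono) (auto simp: field_simps)
    also have "\<dots> = (\<bar>L\<bar> / (a * a) * norm (x - y)) * norm p" by simp
    finally have "norm p * norm p \<le> (\<bar>L\<bar> / (a * a) * norm (x - y)) * norm p" by (simp add: power2_eq_square)
    from mult_right_le_imp_le[OF this] p(2) show ?thesis unfolding p_def[symmetric] by simp
  qed
  have "smooth_norm N a b (\<bar>L\<bar> / (a * a)) D"
    by unfold_locales (use N a b D1 D2 D3 in auto)
  then show thesis by (rule that)
qed

context smooth_norm
begin

lemma N_pos: "x \<noteq> 0 \<Longrightarrow> 0 < N x"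
  using is_normD(1,2)[OF N, of x] by (simp add: order_less_le)

lemma N_le_norm: "N x \<le> norm x / a"
  using a(1) a(2)[of x] by (simp add: field_simps)

lemma N_minus_commute: "N (x - y) = N (y - x)"
  using is_normD(3)[OF N, of "-1" "x - y"] by simp

lemma N_lipschitz: "\<bar>N x - N y\<bar> \<le> norm (x - y) / a"
proof -
  have "N x \<le> N (x - y) + N y" using is_normD(4)[OF N, of "x - y" y] by simp
  moreover have "N y \<le> N (y - x) + N x" using is_normD(4)[OF N, of "y - x" x] by simp
  ultimately show ?thesis using N_le_norm[of "x - y"] N_minus_commute[of x y] by linarith
qed

text \<open>
  The radial projection to the unit sphere is Lipschitz outside every ball around \<open>0\<close>.
\<close>

lemma D_lipschitz_outside:
  assumes "0 < \<delta>" "\<delta> \<le> N x" "\<delta> \<le> N y"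
  shows "norm (D x - D y) \<le> L * ((1 + b / a) / \<delta>) * norm (x - y)"
proof -
  have nz: "x \<noteq> 0" "y \<noteq> 0" using assms is_normD(2)[OF N, of 0] by auto
  have pos: "0 < N x" "0 < N y" using assms by linarith+
  let ?x = "(1 / N x) *\<^sub>R x" and ?y = "(1 / N y) *\<^sub>R y"
  have 1: "N ?x = 1" "N ?y = 1" using pos by (simp_all add: is_normD(3)[OF N])
  have "norm (?x - ?y) \<le> (1 + b / a) / \<delta> * norm (x - y)"
  proof -
    have "?x - ?y = (1 / N x) *\<^sub>R (x - y) + ((N y - N x) / N x) *\<^sub>R ?y"
      using pos by (simp add: algebra_simps diff_divide_distrib)
    then have "norm (?x - ?y) \<le> norm ((1 / N x) *\<^sub>R (x - y)) + norm (((N y - N x) / N x) *\<^sub>R ?y)"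
      using norm_triangle_ineq by metis
    also have "\<dots> = norm (x - y) / N x + \<bar>N y - N x\<bar> / N x * norm ?y" using pos by simp
    also have "\<dots> \<le> norm (x - y) / N x + (norm (x - y) / a) / N x * b"
      using b(2)[of ?y] N_lipschitz[of y x] pos 1 a(1)
      by (intro add_left_mono mult_mono divide_right_mono) (auto simp: norm_minus_commute)
    also have "\<dots> = (1 + b / a) * norm (x - y) / N x"
      by (simp add: add_divide_distrib distrib_right)
    also have "\<dots> \<le> (1 + b / a) * norm (x - y) / \<delta>"
      using assms a b by (intro divide_left_mono) auto
    finally show ?thesis by simp
  qed
  then have "norm (D ?x - D ?y) \<le> L * ((1 + b / a) / \<delta> * norm (x - y))"
    using D_lip[OF 1] L by (meson mult_left_mono order_trans)
  then show ?thesis using D_scale nz pos by (simp add: mult.assoc)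
qed

lemma N_mean_value:
  assumes "\<And>t. 0 \<le> t \<Longrightarrow> t \<le> 1 \<Longrightarrow> x + t *\<^sub>R h \<noteq> 0"
  obtains z where "0 < z" "z < 1" "N (x + h) - N x = D (x + z *\<^sub>R h) \<bullet> h"
proof -
  have "((\<lambda>t. N (x + t *\<^sub>R h)) has_real_derivative D (x + t *\<^sub>R h) \<bullet> h) (at t)" if "0 \<le> t" "t \<le> 1" for t
  proof -
    have "((\<lambda>t. x + t *\<^sub>R h) has_derivative (\<lambda>s. s *\<^sub>R h)) (at t)"
      by (intro derivative_eq_intros) auto
    from has_derivative_compose[OF this D[OF assms[OF that]]]
    show ?thesis unfolding has_field_derivative_def by (simp add: mult_ac mult_commute_abs)
  qed
  from MVT2[OF zero_less_one this, simplified] obtain z where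
    "0 < z" "z < 1" "N (x + h) - N x = D (x + z *\<^sub>R h) \<bullet> h" by auto
  then show thesis by (rule that)
qed

text \<open>
  The bound on the segment keeps it away from \<open>0\<close>, where \<open>N\<close> has no derivative.
\<close>

lemma N_second_order:
  assumes "0 < \<delta>" "\<And>t. 0 \<le> t \<Longrightarrow> t \<le> 1 \<Longrightarrow> \<delta> \<le> N (x + t *\<^sub>R h)"
  shows "N (x + h) \<le> N x + D x \<bullet> h + L * ((1 + b / a) / \<delta>) * (norm h)\<^sup>2"
proof -
  have "x + t *\<^sub>R h \<noteq> 0" if "0 \<le> t" "t \<le> 1" for t
    using assms(2)[OF that] assms(1) is_normD(2)[OF N, of 0] by auto
  then obtain z where z: "0 < z" "z < 1" "N (x + h) - N x = D (x + z *\<^sub>R h) \<bullet> h"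
    by (rule N_mean_value)
  define K where "K = L * ((1 + b / a) / \<delta>)"
  have K: "0 \<le> K" using L a b assms(1) by (simp add: K_def)
  have "D (x + z *\<^sub>R h) \<bullet> h - D x \<bullet> h = (D (x + z *\<^sub>R h) - D x) \<bullet> h" by (simp add: inner_diff_left)
  also have "\<dots> \<le> norm (D (x + z *\<^sub>R h) - D x) * norm h" by (rule norm_cauchy_schwarz)
  also have "\<dots> \<le> (K * norm (z *\<^sub>R h)) * norm h"
    using D_lipschitz_outside[OF assms(1), of "x + z *\<^sub>R h" x] assms(2)[of z] assms(2)[of 0] z
    by (intro mult_right_mono) (auto simp: K_def)
  also have "\<dots> \<le> (K * norm h) * norm h"
    using z K by (intro mult_right_mono mult_left_mono) (auto intro: mult_left_le_one_le)
  finally show ?thesis using z(3) by (simp add: K_def power2_eq_square)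
qed

text \<open>
  On the segment from \<open>x\<close> to \<open>2 *\<^sub>R x\<close> the gradient is constant, so the mean value theorem there gives Euler's
  relation \<open>N x = D x \<bullet> x\<close>.
\<close>

lemma D_lower: 
  assumes "x \<noteq> 0" shows "1 / b \<le> norm (D x)"
proof -
  have nz: "x + t *\<^sub>R x \<noteq> 0" if "0 \<le> t" "t \<le> 1" for t
  proof -
    have "x + t *\<^sub>R x = (1 + t) *\<^sub>R x" by (simp add: scaleR_left_distrib)
    then show ?thesis using assms that by auto
  qed
  then obtain z where z: "0 < z" "z < 1" "N (x + x) - N x = D (x + z *\<^sub>R x) \<bullet> x"
    by (rule N_mean_value)
  have "x + z *\<^sub>R x = (1 + z) *\<^sub>R x" by (simp add: scaleR_left_distrib)
  then have "D (x + z *\<^sub>R x) = D x" using D_scale[OF assms, of "1 + z"] z by simp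
  moreover have "N (x + x) = 2 * N x" using is_normD(3)[OF N, of 2 x] by (simp add: scaleR_2)
  ultimately have "N x = D x \<bullet> x" using z(3) by simp
  also have "\<dots> \<le> norm (D x) * norm x" by (rule norm_cauchy_schwarz)
  also have "\<dots> \<le> norm (D x) * (b * N x)" by (intro mult_left_mono b) auto
  finally show ?thesis using N_pos[OF assms] b(1) by (simp add: field_simps)
qed

text \<open>
  By homogeneity \<open>D\<close> takes all its values on the unit sphere, which is bounded, and \<open>D\<close> is Lipschitz there.
\<close>

lemma D_upper: "\<exists>M. \<forall>x. x \<noteq> 0 \<longrightarrow> norm (D x) \<le> M"
proof -
  obtain x0 :: 'a where x0: "x0 \<noteq> 0" using nonempty_Basis nonzero_Basis by blast
  have unit: "N ((1 / N x) *\<^sub>R x) = 1" "D ((1 / N x) *\<^sub>R x) = D x" "norm ((1 / N x) *\<^sub>R x) \<le> b" if "x \<noteq> 0" for x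
  proof -
    show 1: "N ((1 / N x) *\<^sub>R x) = 1" using N_pos[OF that] by (simp add: is_normD(3)[OF N])
    show "D ((1 / N x) *\<^sub>R x) = D x" using N_pos[OF that] by (intro D_scale that) simp
    show "norm ((1 / N x) *\<^sub>R x) \<le> b" using b(2)[of "(1 / N x) *\<^sub>R x"] unfolding 1 by simp
  qed
  have "norm (D x) \<le> norm (D x0) + L * (2 * b)" if "x \<noteq> 0" for x
  proof -
    have "norm (D x - D x0) \<le> L * norm ((1 / N x) *\<^sub>R x - (1 / N x0) *\<^sub>R x0)"
      using D_lip[OF unit(1)[OF that] unit(1)[OF x0]] unfolding unit(2)[OF that] unit(2)[OF x0] .
    also have "\<dots> \<le> L * (2 * b)"
      using unit(3)[OF that] unit(3)[OF x0] L
        norm_triangle_ineq4[of "(1 / N x) *\<^sub>R x" "(1 / N x0) *\<^sub>R x0"] by (intro mult_left_mono) linarith+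
    finally show ?thesis using norm_triangle_sub[of "D x" "D x0"] by linarith
  qed
  then show ?thesis by blast
qed

lemma dist_fun_le: "y \<in> F \<Longrightarrow> dist_fun N x F \<le> N (x - y)"
  unfolding dist_fun_def by (rule cINF_lower) (auto intro!: bdd_belowI2 is_normD(1)[OF N])

lemma continuous_N: "continuous_on S N"
  by (rule lipschitz_on_continuous_on[of "1 / a"], rule lipschitz_onI)
    (use N_lipschitz a in \<open>auto simp: dist_norm\<close>)

lemma foot_point:
  assumes F: "closed F" "F \<noteq> {}"
  obtains y where "y \<in> F" "dist_fun N x F = N (x - y)"
proof -
  obtain y0 where y0: "y0 \<in> F" using F by blast
  define K where "K = F \<inter> cball x (b * N (x - y0))"
  have "compact K" unfolding K_def by (intro closed_Int_compact F compact_cball)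
  moreover have "y0 \<in> K" using y0 b(2)[of "x - y0"] by (simp add: K_def dist_norm)
  moreover have "continuous_on K (\<lambda>y. N (x - y))"
    by (rule continuous_on_compose2[OF continuous_N[of UNIV]]) (auto intro!: continuous_intros)
  ultimately obtain y where y: "y \<in> K" "\<And>y'. y' \<in> K \<Longrightarrow> N (x - y) \<le> N (x - y')"
    using continuous_attains_inf[of K "\<lambda>y. N (x - y)"] by blast
  have "N (x - y) \<le> N (x - y')" if "y' \<in> F" for y'
  proof (cases "y' \<in> K")
    case False
    then have "b * N (x - y0) < norm (x - y')" using that by (simp add: K_def dist_norm)
    then have "b * N (x - y0) < b * N (x - y')" using b(2)[of "x - y'"] by linarith
    then have "N (x - y0) < N (x - y')" using b(1) by simp
    then show ?thesis using y(2)[OF \<open>y0 \<in> K\<close>] by linarith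
  qed (rule y(2))
  then have "N (x - y) \<le> dist_fun N x F" unfolding dist_fun_def by (intro cINF_greatest F)
  then show thesis using that[of y] y(1) dist_fun_le[of y F x] by (auto simp: K_def)
qed

lemma dist_fun_lipschitz:
  assumes F: "closed F" "F \<noteq> {}"
  shows "\<bar>dist_fun N x F - dist_fun N y F\<bar> \<le> norm (x - y) / a"
proof -
  have "dist_fun N x F - dist_fun N y F \<le> N (x - y)" for x y
  proof -
    obtain z where z: "z \<in> F" "dist_fun N y F = N (y - z)" using foot_point[OF F] .
    have "dist_fun N x F \<le> N (x - z)" by (rule dist_fun_le[OF z(1)])
    also have "\<dots> \<le> N (x - y) + N (y - z)" using is_normD(4)[OF N, of "x - y" "y - z"] by simp
    finally show ?thesis using z(2) by linarith
  qed
  from this[of x y] this[of y x] show ?thesis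
    using N_le_norm[of "x - y"] N_minus_commute[of x y] by linarith
qed

lemma continuous_dist_fun:
  assumes F: "closed F" "F \<noteq> {}"
  shows "continuous_on S (\<lambda>x. dist_fun N x F)"
  by (rule lipschitz_on_continuous_on[of "1 / a"], rule lipschitz_onI)
    (use dist_fun_lipschitz[OF F] a in \<open>auto simp: dist_norm\<close>)

text \<open>
  The supergradient at \<open>z\<close> is the gradient of \<open>w \<mapsto> N (w - y)\<close> for a nearest point \<open>y\<close> of \<open>F\<close>.  On a small
  ball around \<open>x0\<close> the distance to \<open>F\<close> is at least half of its value at \<open>x0\<close>.  As the ball is convex, the
  segments in the second-order estimate stay that far from \<open>y\<close>, so one constant \<open>C\<close> serves for all points.
\<close>

lemma dist_fun_supergradients:
  assumes F: "closed F" "F \<noteq> {}" and x0: "0 < dist_fun N x0 F"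
  obtains R C m M where "0 < R" "0 \<le> C" "0 < m"
    "\<And>z. z \<in> ball x0 R \<Longrightarrow>
      \<exists>p. m \<le> norm p \<and> norm p \<le> M \<and> supergradient (ball x0 R) C (\<lambda>x. dist_fun N x F) z p"
proof -
  define \<delta> where "\<delta> = dist_fun N x0 F / 2"
  define R where "R = a * \<delta>"
  define C where "C = L * ((1 + b / a) / \<delta>)"
  have \<delta>: "0 < \<delta>" using x0 by (simp add: \<delta>_def)
  have R: "0 < R" using a \<delta> by (simp add: R_def)
  have C: "0 \<le> C" using L a b \<delta> by (simp add: C_def)
  obtain M where M: "\<And>x. x \<noteq> 0 \<Longrightarrow> norm (D x) \<le> M" using D_upper by blast
  have away: "\<delta> \<le> dist_fun N u F" if "u \<in> ball x0 R" for u
  proof -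
    have "norm (x0 - u) / a \<le> \<delta>" using that a by (simp add: R_def dist_norm field_simps)
    then have "\<bar>dist_fun N x0 F - dist_fun N u F\<bar> \<le> \<delta>" using dist_fun_lipschitz[OF F, of x0 u] by linarith
    then have "dist_fun N x0 F - dist_fun N u F \<le> \<delta>" by (rule abs_le_D1)
    then show ?thesis by (simp add: \<delta>_def)
  qed
  show thesis
  proof (rule that[OF R C])
    show "0 < 1 / b" using b by simp
    fix z assume z: "z \<in> ball x0 R"
    obtain y where y: "y \<in> F" "dist_fun N z F = N (z - y)" using foot_point[OF F] .
    have "0 < N (z - y)" using away[OF z] \<delta> y(2) by linarith
    then have nz: "z - y \<noteq> 0" using is_normD(2)[OF N, of 0] by force
    have "supergradient (ball x0 R) C (\<lambda>x. dist_fun N x F) z (D (z - y))"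
      unfolding supergradient_def
    proof
      fix w assume w: "w \<in> ball x0 R"
      have "\<delta> \<le> N ((z - y) + t *\<^sub>R (w - z))" if t: "0 \<le> t" "t \<le> 1" for t
      proof -
        have "(1 - t) *\<^sub>R z + t *\<^sub>R w \<in> ball x0 R"
          using convexD_alt[OF convex_ball z w t] .
        then have "\<delta> \<le> N ((1 - t) *\<^sub>R z + t *\<^sub>R w - y)" using away dist_fun_le[OF y(1)] order_trans by blast
        also have "(1 - t) *\<^sub>R z + t *\<^sub>R w - y = (z - y) + t *\<^sub>R (w - z)" by (simp add: algebra_simps)
        finally show ?thesis .
      qed
      from N_second_order[OF \<delta> this]
      have "N (w - y) \<le> N (z - y) + D (z - y) \<bullet> (w - z) + C * (norm (w - z))\<^sup>2" by (simp add: C_def)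
      then show "dist_fun N w F \<le> dist_fun N z F + D (z - y) \<bullet> (w - z) + C * (norm (w - z))\<^sup>2"
        using dist_fun_le[OF y(1), of w] y(2) by linarith
    qed
    then show "\<exists>p. 1 / b \<le> norm p \<and> norm p \<le> M \<and> supergradient (ball x0 R) C (\<lambda>x. dist_fun N x F) z p"
      using D_lower[OF nz] M[OF nz] by blast
  qed
qed

end

section \<open>Descent points\<close>

text \<open>
  The direction and the rate are the same for all points near \<open>x\<close>; this uniformity makes the condition open.
\<close>

definition descent_point :: "('a::real_inner \<Rightarrow> real) \<Rightarrow> 'a \<Rightarrow> bool" where
  "descent_point f x \<longleftrightarrow> (\<exists>v \<eta> \<delta>. norm v = 1 \<and> 0 < \<eta> \<and> 0 < \<delta> \<and>
     (\<forall>z t. z \<in> ball x \<delta> \<longrightarrow> 0 \<le> t \<longrightarrow> z + t *\<^sub>R v \<in> ball x \<delta> \<longrightarrow> f (z + t *\<^sub>R v) \<le> f z - \<eta> * t))"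

lemma open_descent_points: "open {x. descent_point f x}"
  unfolding open_contains_ball
proof
  fix x assume "x \<in> {x. descent_point f x}"
  then obtain v \<eta> \<delta> where d: "norm v = 1" "0 < \<eta>" "0 < \<delta>"
    "\<And>z t. z \<in> ball x \<delta> \<Longrightarrow> 0 \<le> t \<Longrightarrow> z + t *\<^sub>R v \<in> ball x \<delta> \<Longrightarrow> f (z + t *\<^sub>R v) \<le> f z - \<eta> * t"
    unfolding descent_point_def by blast
  have "descent_point f y" if y: "y \<in> ball x \<delta>" for y
  proof -
    obtain \<delta>' where \<delta>': "0 < \<delta>'" "ball y \<delta>' \<subseteq> ball x \<delta>" using y openE[OF open_ball] by metis
    then show ?thesis unfolding descent_point_def using d by (intro exI[of _ v] exI[of _ \<eta>] exI[of _ \<delta>']) blast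
  qed
  then show "\<exists>e>0. ball x e \<subseteq> {x. descent_point f x}" using d(3) by blast
qed

lemma supergradients_eq_halfspaces:
  "{p. supergradient U C f x p} = (\<Inter>w\<in>U. {p. (w - x) \<bullet> p \<ge> f w - f x - C * (norm (w - x))\<^sup>2})"
  unfolding supergradient_def by (auto simp: inner_commute algebra_simps)

text \<open>
  Upper semicontinuity of the set of supergradients: limits of bounded supergradients at points that
  converge to \<open>x\<close> are supergradients at \<open>x\<close>.
\<close>

lemma supergradients_near:
  fixes f :: "'a::euclidean_space \<Rightarrow> real"
  assumes U: "open U" "x \<in> U" and f: "continuous_on U f" and V: "open V"
    and sub: "\<And>p. norm p \<le> M \<Longrightarrow> supergradient U C f x p \<Longrightarrow> p \<in> V"
  obtains \<delta> where "0 < \<delta>" "ball x \<delta> \<subseteq> U"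
    "\<And>z p. z \<in> ball x \<delta> \<Longrightarrow> norm p \<le> M \<Longrightarrow> supergradient U C f z p \<Longrightarrow> p \<in> V"
proof -
  obtain \<delta>0 where \<delta>0: "0 < \<delta>0" "ball x \<delta>0 \<subseteq> U" using openE[OF U] .
  have "\<exists>\<delta>. 0 < \<delta> \<and> \<delta> \<le> \<delta>0 \<and> (\<forall>z p. z \<in> ball x \<delta> \<longrightarrow> norm p \<le> M \<longrightarrow> supergradient U C f z p \<longrightarrow> p \<in> V)"
  proof (rule ccontr)
    assume neg: "\<not> ?thesis"
    define P where "P n z p \<longleftrightarrow> z \<in> ball x (min \<delta>0 (inverse (real (Suc n)))) \<and> norm p \<le> M \<and> supergradient U C f z p \<and> p \<notin> V" for n z p
    have "\<exists>z p. P n z p" for n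
      using neg \<delta>0(1) unfolding P_def by (auto dest!: spec[of _ "min \<delta>0 (inverse (real (Suc n)))"])
    then obtain z p where zp: "\<And>n. P n (z n) (p n)" by metis
    have "\<forall>n. p n \<in> cball 0 M" using zp by (simp add: P_def)
    then obtain q \<sigma> where q: "strict_mono \<sigma>" "(p \<circ> \<sigma>) \<longlonglongrightarrow> q" "q \<in> cball 0 M"
      using compact_cball[of 0 M] unfolding compact_def by blast
    have "z \<longlonglongrightarrow> x"
    proof (rule metric_tendsto_imp_tendsto[OF LIMSEQ_inverse_real_of_nat])
      have "dist (z n) x \<le> dist (inverse (real (Suc n))) 0" for n
        using zp[of n] by (auto simp: P_def dist_commute)
      then show "\<forall>\<^sub>F n in sequentially. dist (z n) x \<le> dist (inverse (real (Suc n))) 0" by simp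
    qed
    then have z: "(z \<circ> \<sigma>) \<longlonglongrightarrow> x" using q(1) by (rule LIMSEQ_subseq_LIMSEQ)
    have "isCont f x" using f U continuous_on_eq_continuous_at by blast
    then have fz: "(\<lambda>n. f ((z \<circ> \<sigma>) n)) \<longlonglongrightarrow> f x" using z by (rule isCont_tendsto_compose)
    have "supergradient U C f x q" unfolding supergradient_def
    proof
      fix w assume w: "w \<in> U"
      have "(\<lambda>n. f ((z \<circ> \<sigma>) n) + (p \<circ> \<sigma>) n \<bullet> (w - (z \<circ> \<sigma>) n) + C * (norm (w - (z \<circ> \<sigma>) n))\<^sup>2)
         \<longlonglongrightarrow> f x + q \<bullet> (w - x) + C * (norm (w - x))\<^sup>2"
        by (intro tendsto_intros fz q(2) z)
      moreover have "f w \<le> f ((z \<circ> \<sigma>) n) + (p \<circ> \<sigma>) n \<bullet> (w - (z \<circ> \<sigma>) n) + C * (norm (w - (z \<circ> \<sigma>) n))\<^sup>2" for n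
        using zp[of "\<sigma> n"] w unfolding P_def supergradient_def by simp
      ultimately show "f w \<le> f x + q \<bullet> (w - x) + C * (norm (w - x))\<^sup>2"
        by (intro LIMSEQ_le_const) auto
    qed
    then have "q \<in> V" using sub q(3) by simp
    then obtain n where "(p \<circ> \<sigma>) n \<in> V"
      using eventually_happens'[OF sequentially_bot topological_tendstoD[OF q(2) V]] by blast
    then show False using zp[of "\<sigma> n"] by (simp add: P_def)
  qed
  then obtain \<delta> where "0 < \<delta>" "\<delta> \<le> \<delta>0"
    "\<forall>z p. z \<in> ball x \<delta> \<longrightarrow> norm p \<le> M \<longrightarrow> supergradient U C f z p \<longrightarrow> p \<in> V" by blast
  then show thesis using that[of \<delta>] \<delta>0(2) subset_ball[of \<delta> \<delta>0 x] by blast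
qed

text \<open>
  If \<open>0\<close> is not a supergradient at \<open>x\<close>, a hyperplane separates it from the closed convex set of
  supergradients at \<open>x\<close>.  By upper semicontinuity, the same hyperplane separates \<open>0\<close> from the bounded
  supergradients at all nearby points, and its normal vector provides the direction of descent.
\<close>

lemma descent_or_zero_supergradient:
  fixes f :: "'a::euclidean_space \<Rightarrow> real"
  assumes U: "open U" "x \<in> U" and f: "continuous_on U f" and C: "0 \<le> C"
    and sg: "\<And>z. z \<in> U \<Longrightarrow> \<exists>p. norm p \<le> M \<and> supergradient U C f z p"
  shows "descent_point f x \<or> supergradient U C f x 0"
proof (rule disjCI)
  assume "\<not> supergradient U C f x 0"
  then have "0 \<notin> {p. supergradient U C f x p}" by simp
  moreover have "convex {p. supergradient U C f x p}" "closed {p. supergradient U C f x p}"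
    unfolding supergradients_eq_halfspaces
    by (intro convex_INT convex_halfspace_ge closed_INT ballI closed_halfspace_ge)+
  ultimately obtain q \<beta> where q: "q \<noteq> 0" "0 < \<beta>" "\<And>p. supergradient U C f x p \<Longrightarrow> \<beta> < q \<bullet> p"
    using separating_hyperplane_closed_0[of "{p. supergradient U C f x p}"] by auto
  have "open {p. \<beta> < q \<bullet> p}" by (rule open_halfspace_gt)
  then obtain \<delta> where \<delta>: "0 < \<delta>" "ball x \<delta> \<subseteq> U"
    "\<And>z p. z \<in> ball x \<delta> \<Longrightarrow> norm p \<le> M \<Longrightarrow> supergradient U C f z p \<Longrightarrow> \<beta> < q \<bullet> p"
    using supergradients_near[OF U f, of "{p. \<beta> < q \<bullet> p}" M C] q(3) by auto
  define v where "v = - (1 / norm q) *\<^sub>R q"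
  define \<eta> where "\<eta> = \<beta> / (2 * norm q)"
  \<comment> \<open>steps inside the ball have length at most \<open>2 * \<epsilon>\<close>, so the quadratic term uses up at most half of the slope\<close>
  define \<epsilon> where "\<epsilon> = min \<delta> (\<eta> / (2 * (C + 1)))"
  have v: "norm v = 1" using q(1) by (simp add: v_def)
  have \<eta>: "0 < \<eta>" using q by (simp add: \<eta>_def)
  have \<epsilon>: "0 < \<epsilon>" "\<epsilon> \<le> \<delta>" "C * (2 * \<epsilon>) \<le> \<eta>"
  proof -
    show "0 < \<epsilon>" using \<delta> \<eta> C by (simp add: \<epsilon>_def)
    show "\<epsilon> \<le> \<delta>" by (simp add: \<epsilon>_def)
    have "C * (2 * \<epsilon>) \<le> (C + 1) * (2 * (\<eta> / (2 * (C + 1))))"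
      using C \<open>0 < \<epsilon>\<close> by (intro mult_mono) (auto simp: \<epsilon>_def)
    also have "\<dots> = \<eta>" using C by (simp add: field_simps)
    finally show "C * (2 * \<epsilon>) \<le> \<eta>" .
  qed
  have "f (z + t *\<^sub>R v) \<le> f z - \<eta> * t" if z: "z \<in> ball x \<epsilon>" and t: "0 \<le> t" and zt: "z + t *\<^sub>R v \<in> ball x \<epsilon>" for z t
  proof -
    have zU: "z \<in> ball x \<delta>" "z \<in> U" "z + t *\<^sub>R v \<in> U" using z zt \<epsilon>(2) \<delta>(2) by auto
    then obtain p where p: "norm p \<le> M" "supergradient U C f z p" using sg by blast
    have "t = dist z (z + t *\<^sub>R v)" using t v by (simp add: dist_norm)
    also have "\<dots> \<le> 2 * \<epsilon>" using dist_triangle_less_add[of z x \<epsilon> "z + t *\<^sub>R v" \<epsilon>] z zt by (simp add: dist_commute)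
    finally have "C * t \<le> \<eta>" using \<epsilon>(3) C mult_left_mono[of t "2 * \<epsilon>" C] by linarith
    then have Ct: "(C * t) * t \<le> \<eta> * t" using t by (rule mult_right_mono)
    have "p \<bullet> v = - (q \<bullet> p) / norm q" by (simp add: v_def inner_commute)
    also have "\<dots> \<le> - \<beta> / norm q" using \<delta>(3)[OF zU(1) p] by (intro divide_right_mono) auto
    also have "\<dots> = - 2 * \<eta>" by (simp add: \<eta>_def)
    finally have "t * (p \<bullet> v) \<le> t * (- 2 * \<eta>)" using t by (rule mult_left_mono)
    moreover have "f (z + t *\<^sub>R v) \<le> f z + t * (p \<bullet> v) + C * t\<^sup>2"
      using p(2) zU(3) v unfolding supergradient_def by (force simp: power_mult_distrib)
    ultimately show ?thesis using Ct by (simp add: power2_eq_square algebra_simps)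
  qed
  then show "descent_point f x" unfolding descent_point_def using v \<eta> \<epsilon>(1) by blast
qed

text \<open>
  For \<open>x\<close>, \<open>y\<close> in \<open>S\<close> the zero supergradient at \<open>x\<close> bounds \<open>f y - f x\<close> from above by a quadratic term.  The
  supergradient \<open>p\<close> at \<open>y\<close>, evaluated at \<open>x\<close>, then gives \<open>p \<bullet> (y - x) \<le> 2 * C * (norm (y - x))\<^sup>2\<close>.  Exchanging
  the two points gives the bound from the other side, and \<open>p\<close> may be replaced by \<open>q\<close> at the cost of
  \<open>m / 4 * norm (y - x)\<close>.
\<close>

lemma two_supergradients_transversal:
  fixes q :: "'a::euclidean_space"
  assumes m: "0 < m" and C: "0 \<le> C" and \<sigma>: "4 * C * \<sigma> \<le> m / 8" and q: "3 * m / 4 \<le> norm q"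
    and S: "S \<subseteq> U \<inter> ball c \<sigma>" and zero: "\<And>z. z \<in> S \<Longrightarrow> supergradient U C f z 0"
    and near: "\<And>z. z \<in> S \<Longrightarrow> \<exists>p. norm (p - q) \<le> m / 4 \<and> supergradient U C f z p"
  shows "transversal ((1 / norm q) *\<^sub>R q) S"
proof -
  have q0: "0 < norm q" using m q by linarith
  have *: "q \<bullet> (y - x) \<le> norm q * norm (y - x) / 2" if xy: "x \<in> S" "y \<in> S" for x y
  proof -
    define w where "w = y - x"
    obtain p where p: "norm (p - q) \<le> m / 4" "supergradient U C f y p" using near[OF xy(2)] by blast
    have "dist x y \<le> 2 * \<sigma>"
      using dist_triangle_less_add[of x c \<sigma> y \<sigma>] xy S by (force simp: dist_commute subset_iff)
    then have w\<sigma>: "norm w \<le> 2 * \<sigma>" by (simp add: w_def dist_norm norm_minus_commute)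
    have "x \<in> U" "y \<in> U" using xy S by auto
    then have "f x \<le> f y + p \<bullet> (x - y) + C * (norm (x - y))\<^sup>2" "f y \<le> f x + C * (norm (y - x))\<^sup>2"
      using p(2) zero[OF xy(1)] unfolding supergradient_def by auto
    moreover have "p \<bullet> (x - y) = - (p \<bullet> w)" "norm (x - y) = norm w" "norm (y - x) = norm w"
      by (simp_all add: w_def inner_diff_right norm_minus_commute)
    ultimately have "p \<bullet> w \<le> (2 * C * norm w) * norm w" by (simp add: power2_eq_square)
    also have "\<dots> \<le> m / 8 * norm w"
    proof (rule mult_right_mono)
      have "2 * C * norm w \<le> 2 * C * (2 * \<sigma>)" using w\<sigma> C by (intro mult_left_mono) auto
      then show "2 * C * norm w \<le> m / 8" using \<sigma> by simp
    qed simp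
    finally have "p \<bullet> w \<le> m / 8 * norm w" .
    moreover have "(q - p) \<bullet> w \<le> m / 4 * norm w"
      using norm_cauchy_schwarz[of "q - p" w] p(1) mult_right_mono[of "norm (q - p)" "m / 4" "norm w"]
      by (simp add: norm_minus_commute)
    ultimately have "q \<bullet> w \<le> (3 * m / 8) * norm w" by (simp add: inner_diff_left algebra_simps)
    also have "\<dots> \<le> (norm q / 2) * norm w" using q by (intro mult_right_mono) auto
    finally show ?thesis by (simp add: w_def)
  qed
  have "\<bar>((1 / norm q) *\<^sub>R q) \<bullet> (x - y)\<bar> \<le> norm (x - y) / 2" if xy: "x \<in> S" "y \<in> S" for x y
  proof -
    have "\<bar>q \<bullet> (x - y)\<bar> \<le> norm q * norm (x - y) / 2"
      using *[OF xy(2,1)] *[OF xy] by (intro abs_leI) (simp_all add: inner_diff_right norm_minus_commute)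
    then show ?thesis using q0 by (simp add: abs_mult field_simps)
  qed
  then show ?thesis using q0 unfolding transversal_def by simp
qed

text \<open>
  The pieces are indexed by a centre and a vector \<open>q\<close> from a countable dense set.
\<close>

lemma critical_points_countable_transversal:
  fixes f :: "'a::euclidean_space \<Rightarrow> real"
  assumes m: "0 < m" and C: "0 \<le> C"
    and Z: "\<And>z. z \<in> Z \<Longrightarrow> z \<in> U \<and> supergradient U C f z 0 \<and> (\<exists>p. m \<le> norm p \<and> supergradient U C f z p)"
  shows "\<exists>\<G>. countable \<G> \<and> Z \<subseteq> \<Union>\<G> \<and> (\<forall>S\<in>\<G>. bounded S \<and> (\<exists>v. transversal v S))"
proof -
  obtain E :: "'a set" where E: "countable E" "\<And>X. open X \<Longrightarrow> X \<noteq> {} \<Longrightarrow> \<exists>d\<in>E. d \<in> X"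
    by (rule countable_dense_setE) blast
  \<comment> \<open>adding \<open>1\<close> to \<open>C\<close> only serves to avoid a division by zero\<close>
  define \<sigma> where "\<sigma> = m / (32 * (C + 1))"
  have \<sigma>: "0 < \<sigma>" "4 * C * \<sigma> \<le> m / 8" using m C by (auto simp: \<sigma>_def field_simps)
  define \<Gamma> where "\<Gamma> = (\<lambda>(c, q). {z \<in> Z \<inter> ball c \<sigma>. \<exists>p. norm (p - q) \<le> m / 4 \<and> supergradient U C f z p})"
  define I where "I = {(c, q). c \<in> E \<and> q \<in> E \<and> 3 * m / 4 \<le> norm q}"
  have "I \<subseteq> E \<times> E" by (auto simp: I_def)
  then have "countable (\<Gamma> ` I)" using E(1) by (meson countable_SIGMA countable_image countable_subset)
  moreover have "Z \<subseteq> \<Union>(\<Gamma> ` I)"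
  proof
    fix z assume z: "z \<in> Z"
    then obtain p where p: "m \<le> norm p" "supergradient U C f z p" using Z by blast
    obtain c where c: "c \<in> E" "c \<in> ball z \<sigma>" using E(2)[of "ball z \<sigma>"] \<sigma> by auto
    obtain q where q: "q \<in> E" "q \<in> ball p (m / 4)" using E(2)[of "ball p (m / 4)"] m by auto
    have pq: "norm (p - q) \<le> m / 4" using q(2) by (simp add: dist_norm)
    then have "3 * m / 4 \<le> norm q" using p(1) norm_triangle_ineq2[of p q] by linarith
    then have "(c, q) \<in> I" using c q by (simp add: I_def)
    moreover have "z \<in> \<Gamma> (c, q)" using z c(2) pq p(2) by (auto simp: \<Gamma>_def dist_commute)
    ultimately show "z \<in> \<Union>(\<Gamma> ` I)" by blast
  qed
  moreover have "bounded (\<Gamma> i) \<and> (\<exists>v. transversal v (\<Gamma> i))" if "i \<in> I" for i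
  proof -
    obtain c q where i: "i = (c, q)" "3 * m / 4 \<le> norm q" using \<open>i \<in> I\<close> by (auto simp: I_def)
    have "transversal ((1 / norm q) *\<^sub>R q) (\<Gamma> i)"
      by (rule two_supergradients_transversal[OF m C \<sigma>(2) i(2), of _ U c f]) (use Z in \<open>auto simp: \<Gamma>_def i\<close>)
    moreover have "bounded (\<Gamma> i)" by (rule bounded_subset[OF bounded_ball[of c \<sigma>]]) (auto simp: \<Gamma>_def i)
    ultimately show ?thesis by blast
  qed
  ultimately show ?thesis by (intro exI[of _ "\<Gamma> ` I"]) blast
qed

text \<open>
  The constants of the local estimate depend on the region, so the pieces are formed on balls; countably
  many of these suffice by the Lindelof property.
\<close>

lemma (in smooth_norm) nondescent_points_countable_transversal:
  assumes F: "closed F" "F \<noteq> {}"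
  shows "\<exists>\<G>. countable \<G> \<and> {x. 0 < dist_fun N x F \<and> \<not> descent_point (\<lambda>x. dist_fun N x F) x} \<subseteq> \<Union>\<G> \<and>
    (\<forall>S\<in>\<G>. bounded S \<and> (\<exists>v. transversal v S))"
proof -
  let ?d = "\<lambda>x. dist_fun N x F"
  define P where "P B \<G> \<longleftrightarrow> countable \<G> \<and> {x\<in>B. \<not> descent_point ?d x} \<subseteq> \<Union>\<G> \<and>
    (\<forall>S\<in>\<G>. bounded S \<and> (\<exists>v. transversal v S))" for B \<G>
  define \<U> where "\<U> = {B. open B \<and> (\<exists>\<G>. P B \<G>)}"
  obtain \<U>' where \<U>': "\<U>' \<subseteq> \<U>" "countable \<U>'" "\<Union>\<U>' = \<Union>\<U>"
    using Lindelof[of \<U>] by (auto simp: \<U>_def)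
  have "\<forall>B\<in>\<U>'. \<exists>\<G>. P B \<G>" using \<U>'(1) by (auto simp: \<U>_def)
  then obtain G where G: "\<And>B. B \<in> \<U>' \<Longrightarrow> P B (G B)" by metis
  have cover: "x \<in> \<Union>\<U>" if x: "0 < ?d x" for x
  proof -
    obtain R C m M where R: "0 < R" and C: "0 \<le> C" and m: "0 < m" and
      sg: "\<And>z. z \<in> ball x R \<Longrightarrow> \<exists>p. m \<le> norm p \<and> norm p \<le> M \<and> supergradient (ball x R) C ?d z p"
      using dist_fun_supergradients[OF F x] by blast
    have sg': "\<exists>p. norm p \<le> M \<and> supergradient (ball x R) C ?d z p" if "z \<in> ball x R" for z
      using sg[OF that] by blast
    have "\<exists>\<G>. P (ball x R) \<G>" unfolding P_def
    proof (rule critical_points_countable_transversal[OF m C, of _ "ball x R" ?d])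
      fix z assume z: "z \<in> {z \<in> ball x R. \<not> descent_point ?d z}"
      then have "supergradient (ball x R) C ?d z 0"
        using descent_or_zero_supergradient[OF open_ball _ continuous_dist_fun[OF F] C sg', of z] by blast
      then show "z \<in> ball x R \<and> supergradient (ball x R) C ?d z 0 \<and>
          (\<exists>p. m \<le> norm p \<and> supergradient (ball x R) C ?d z p)"
        using z sg by blast
    qed
    then have "ball x R \<in> \<U>" by (simp add: \<U>_def)
    then show ?thesis using R centre_in_ball by blast
  qed
  have "{x. 0 < ?d x \<and> \<not> descent_point ?d x} \<subseteq> \<Union>(\<Union>(G ` \<U>'))"
  proof clarify
    fix x assume x: "0 < ?d x" "\<not> descent_point ?d x"
    obtain B where B: "B \<in> \<U>'" "x \<in> B" using cover[OF x(1)] \<U>'(3) by blast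
    then have "x \<in> \<Union>(G B)" using G[OF B(1)] x(2) unfolding P_def by blast
    then show "x \<in> \<Union>(\<Union>(G ` \<U>'))" using B(1) by blast
  qed
  moreover have "countable (\<Union>(G ` \<U>'))" using \<U>'(2) G unfolding P_def by (intro countable_UN) auto
  moreover have "bounded S \<and> (\<exists>v. transversal v S)" if "S \<in> \<Union>(G ` \<U>')" for S
    using that G unfolding P_def by blast
  ultimately show ?thesis by blast
qed

section \<open>Level sets near descent points\<close>

lemma convex_combination_norm_sq:
  fixes x y :: "'a::real_inner"
  assumes "\<alpha> + \<beta> = 1"
  shows "\<alpha> * (norm x)\<^sup>2 + \<beta> * (norm y)\<^sup>2 - (norm (\<alpha> *\<^sub>R x + \<beta> *\<^sub>R y))\<^sup>2 = \<alpha> * \<beta> * (norm (x - y))\<^sup>2"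
proof -
  have \<beta>: "\<beta> = 1 - \<alpha>" using assms by simp
  show ?thesis unfolding \<beta> power2_norm_eq_inner
    by (simp add: inner_add inner_diff inner_commute algebra_simps)
qed

text \<open>
  A supergradient at the convex combination bounds \<open>f\<close> at both end points; in the weighted sum the linear
  terms cancel.
\<close>

lemma supergradient_semiconcavity:
  assumes p: "supergradient U C f (\<alpha> *\<^sub>R x + \<beta> *\<^sub>R y) p" and xy: "x \<in> U" "y \<in> U"
    and lm: "0 \<le> \<alpha>" "0 \<le> \<beta>" "\<alpha> + \<beta> = 1"
  shows "\<alpha> * f x + \<beta> * f y - C * (\<alpha> * \<beta> * (norm (x - y))\<^sup>2) \<le> f (\<alpha> *\<^sub>R x + \<beta> *\<^sub>R y)"
proof -
  define z where "z = \<alpha> *\<^sub>R x + \<beta> *\<^sub>R y"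
  have \<beta>: "\<beta> = 1 - \<alpha>" using lm by simp
  have x: "x - z = \<beta> *\<^sub>R (x - y)" and y: "y - z = \<alpha> *\<^sub>R (y - x)"
    by (simp_all add: z_def \<beta> algebra_simps)
  have fx: "f x \<le> f z + p \<bullet> (x - z) + C * (norm (x - z))\<^sup>2" and fy: "f y \<le> f z + p \<bullet> (y - z) + C * (norm (y - z))\<^sup>2"
    using p xy by (auto simp: supergradient_def z_def)
  have "\<alpha> * f x + \<beta> * f y \<le> \<alpha> * (f z + p \<bullet> (x - z) + C * (norm (x - z))\<^sup>2) + \<beta> * (f z + p \<bullet> (y - z) + C * (norm (y - z))\<^sup>2)"
    by (intro add_mono mult_left_mono fx fy lm)
  also have "\<dots> = f z + C * (\<alpha> * \<beta> * (norm (x - y))\<^sup>2)"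
    unfolding x y norm_scaleR power_mult_distrib power2_abs norm_minus_commute[of y x]
    by (simp add: \<beta> inner_diff_right algebra_simps power2_eq_square)
  finally show ?thesis by (simp add: z_def)
qed

lemma concave_on_minus_norm_sq:
  fixes D :: "'a::real_inner set"
  assumes "convex D" and
    s: "\<And>x y \<alpha> \<beta>. x \<in> D \<Longrightarrow> y \<in> D \<Longrightarrow> 0 \<le> \<alpha> \<Longrightarrow> 0 \<le> \<beta> \<Longrightarrow> \<alpha> + \<beta> = 1 \<Longrightarrow>
      \<alpha> * s x + \<beta> * s y - K * (\<alpha> * \<beta> * (norm (x - y))\<^sup>2) \<le> s (\<alpha> *\<^sub>R x + \<beta> *\<^sub>R y)"
  shows "semiconcave_on D s"
  unfolding semiconcave_on_def concave_on_iff
proof (intro exI[of _ "2 * K"] conjI ballI allI impI assms(1))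
  fix x y \<alpha> \<beta> assume *: "x \<in> D" "y \<in> D" "0 \<le> \<alpha>" "0 \<le> \<beta>" "\<alpha> + \<beta> = (1::real)"
  have "K * (\<alpha> * (norm x)\<^sup>2 + \<beta> * (norm y)\<^sup>2 - (norm (\<alpha> *\<^sub>R x + \<beta> *\<^sub>R y))\<^sup>2) = K * (\<alpha> * \<beta> * (norm (x - y))\<^sup>2)"
    unfolding convex_combination_norm_sq[OF *(5), of x y] ..
  with s[OF *] show "\<alpha> * (s x - 2 * K / 2 * (norm x)\<^sup>2) + \<beta> * (s y - 2 * K / 2 * (norm y)\<^sup>2)
      \<le> s (\<alpha> *\<^sub>R x + \<beta> *\<^sub>R y) - 2 * K / 2 * (norm (\<alpha> *\<^sub>R x + \<beta> *\<^sub>R y))\<^sup>2"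
    by (simp add: algebra_simps)
qed

lemma semiconcave_on_subset:
  assumes "semiconcave_on D s" "D' \<subseteq> D" "convex D'"
  shows "semiconcave_on D' s"
  using assms unfolding semiconcave_on_def concave_on_def by (blast intro: convex_on_subset)

text \<open>
  In a small cylinder around \<open>x0\<close> with axis in the descent direction \<open>v\<close>, the function \<open>f\<close> is strictly
  decreasing along the axis and exceeds \<open>r\<close> on the bottom and is below \<open>r\<close> on the top.  So each line parallel
  to \<open>v\<close> contains exactly one point of the level set, at height \<open>s u\<close>.  Moving up by \<open>t - s u\<close> costs at least
  \<open>\<eta> * (t - s u)\<close>, hence \<open>\<eta> * (t - s u) \<le> r - f (u + t *\<^sub>R v)\<close> for heights \<open>t\<close> above the level set (\<open>s_ge\<close>).
  With the Lipschitz bound for \<open>f\<close> this makes \<open>s\<close> Lipschitz; with the semiconcavity inequality for \<open>f\<close> at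
  the convex combination of two points of the graph it makes \<open>s\<close> semiconcave.
\<close>

lemma level_set_semiconcave_graph:
  fixes f :: "'a::euclidean_space \<Rightarrow> real"
  assumes x0: "descent_point f x0" "f x0 = r" and U: "open U" "x0 \<in> U" and C: "0 \<le> C"
    and sg: "\<forall>z\<in>U. \<exists>p. supergradient U C f z p"
    and \<Lambda>: "0 < \<Lambda>" and lip: "\<And>x y. \<bar>f x - f y\<bar> \<le> \<Lambda> * norm (x - y)"
    and T: "open T" "x0 \<in> T"
  shows "\<exists>Q W D v s. subspace Q \<and> dim Q = DIM('a) - 1 \<and> open W \<and> x0 \<in> W \<and> W \<subseteq> T \<and>
        openin (top_of_set Q) D \<and> v \<noteq> 0 \<and> v \<in> orthogonal_comp Q \<and>
        locally_semiconcave_in Q D s \<and> {x. f x = r} \<inter> W = (\<lambda>u. u + s u *\<^sub>R v) ` D"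
proof -
  obtain v \<eta> \<delta>0 where v: "norm v = 1" and \<eta>: "0 < \<eta>" and \<delta>0: "0 < \<delta>0" and
    desc: "\<And>z t. z \<in> ball x0 \<delta>0 \<Longrightarrow> 0 \<le> t \<Longrightarrow> z + t *\<^sub>R v \<in> ball x0 \<delta>0 \<Longrightarrow> f (z + t *\<^sub>R v) \<le> f z - \<eta> * t"
    using x0 unfolding descent_point_def by blast
  obtain \<delta> where \<delta>: "0 < \<delta>" "ball x0 \<delta> \<subseteq> U \<inter> T \<inter> ball x0 \<delta>0"
    using U T \<delta>0 openE[of "U \<inter> T \<inter> ball x0 \<delta>0" x0] by auto
  have vv: "v \<bullet> v = 1" using v by (simp add: norm_eq_1)
  define t0 where "t0 = v \<bullet> x0"
  define u0 where "u0 = x0 - t0 *\<^sub>R v"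
  define \<tau> where "\<tau> = \<delta> / 3"
  \<comment> \<open>\<open>\<Lambda> * \<rho> < \<eta> * \<tau>\<close> keeps the sign of \<open>f - r\<close> on the bottom and on the top of the cylinder\<close>
  define \<rho> where "\<rho> = min (\<delta> / 3) (\<eta> * \<tau> / (2 * \<Lambda>))"
  define Q where "Q = {y. v \<bullet> y = 0}"
  define D where "D = Q \<inter> ball u0 \<rho>"
  define W where "W = {y. y - (v \<bullet> y) *\<^sub>R v \<in> ball u0 \<rho>} \<inter> {y. \<bar>v \<bullet> y - t0\<bar> < \<tau>}"
  have \<tau>: "0 < \<tau>" using \<delta> by (simp add: \<tau>_def)
  have \<rho>: "0 < \<rho>" "\<rho> \<le> \<delta> / 3" "\<Lambda> * \<rho> < \<eta> * \<tau>"
  proof -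
    show "0 < \<rho>" "\<rho> \<le> \<delta> / 3" using \<delta> \<eta> \<tau> \<Lambda> by (auto simp: \<rho>_def)
    have "\<Lambda> * \<rho> \<le> \<Lambda> * (\<eta> * \<tau> / (2 * \<Lambda>))" using \<Lambda> by (intro mult_left_mono) (auto simp: \<rho>_def)
    also have "\<dots> = \<eta> * \<tau> / 2" using \<Lambda> by simp
    finally show "\<Lambda> * \<rho> < \<eta> * \<tau>" using mult_pos_pos[OF \<eta> \<tau>] by linarith
  qed
  have u0: "u0 \<in> Q" using vv by (simp add: Q_def u0_def t0_def inner_diff_right)
  have x0_eq: "x0 = u0 + t0 *\<^sub>R v" by (simp add: u0_def)
  have inball: "u + t *\<^sub>R v \<in> ball x0 \<delta>" if "u \<in> ball u0 \<rho>" "\<bar>t - t0\<bar> \<le> \<tau>" for u t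
  proof -
    have "norm ((u + t *\<^sub>R v) - x0) \<le> norm (u - u0) + norm ((t - t0) *\<^sub>R v)"
      using norm_triangle_ineq[of "u - u0" "(t - t0) *\<^sub>R v"] by (simp add: x0_eq algebra_simps)
    also have "\<dots> < \<delta> / 3 + \<delta> / 3"
      using that \<rho>(2) v by (intro add_less_le_mono) (auto simp: dist_norm norm_minus_commute \<tau>_def)
    finally show ?thesis using \<delta>(1) by (simp add: dist_norm norm_minus_commute)
  qed
  have mono: "f (u + t' *\<^sub>R v) \<le> f (u + t *\<^sub>R v) - \<eta> * (t' - t)"
    if "u \<in> ball u0 \<rho>" "\<bar>t - t0\<bar> \<le> \<tau>" "\<bar>t' - t0\<bar> \<le> \<tau>" "t \<le> t'" for u t t'
  proof -
    have eq: "(u + t *\<^sub>R v) + (t' - t) *\<^sub>R v = u + t' *\<^sub>R v" by (simp add: algebra_simps)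
    have "u + t *\<^sub>R v \<in> ball x0 \<delta>0" "u + t' *\<^sub>R v \<in> ball x0 \<delta>0"
      using inball[OF that(1,2)] inball[OF that(1,3)] \<delta>(2) by blast+
    then show ?thesis using desc[of "u + t *\<^sub>R v" "t' - t"] that(4) unfolding eq by simp
  qed
  have contf: "continuous_on S f" for S
    by (rule lipschitz_on_continuous_on[of \<Lambda>], rule lipschitz_onI) (use lip \<Lambda> in \<open>auto simp: dist_norm\<close>)
  have ex: "\<exists>t. \<bar>t - t0\<bar> < \<tau> \<and> f (u + t *\<^sub>R v) = r" if u: "u \<in> ball u0 \<rho>" for u
  proof -
    have c: "u0 \<in> ball u0 \<rho>" using \<rho> by simp
    have "norm (u - u0) < \<rho>" using u by (simp add: dist_norm norm_minus_commute)
    then have "\<Lambda> * norm (u - u0) < \<eta> * \<tau>" using \<rho>(3) \<Lambda> mult_left_mono[of "norm (u - u0)" \<rho> \<Lambda>] by linarith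
    then have near: "\<bar>f (u + t *\<^sub>R v) - f (u0 + t *\<^sub>R v)\<bar> < \<eta> * \<tau>" for t
      using lip[of "u + t *\<^sub>R v" "u0 + t *\<^sub>R v"] by simp
    have "f (u0 + (t0 + \<tau>) *\<^sub>R v) \<le> r - \<eta> * \<tau>" "r \<le> f (u0 + (t0 - \<tau>) *\<^sub>R v) - \<eta> * \<tau>"
      using mono[OF c, of t0 "t0 + \<tau>"] mono[OF c, of "t0 - \<tau>" t0] \<tau> x0(2) unfolding x0_eq[symmetric] by simp_all
    then have ends: "f (u + (t0 + \<tau>) *\<^sub>R v) < r" "r < f (u + (t0 - \<tau>) *\<^sub>R v)"
      using near[of "t0 + \<tau>"] near[of "t0 - \<tau>"] by linarith+
    have "continuous_on {t0 - \<tau>..t0 + \<tau>} (\<lambda>t. f (u + t *\<^sub>R v))"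
      by (rule continuous_on_compose2[OF contf[of UNIV]]) (auto intro!: continuous_intros)
    then obtain t where t: "t0 - \<tau> \<le> t" "t \<le> t0 + \<tau>" "f (u + t *\<^sub>R v) = r"
      using IVT2'[of "\<lambda>t. f (u + t *\<^sub>R v)" "t0 + \<tau>" r "t0 - \<tau>"] ends \<tau> by auto
    moreover have "t \<noteq> t0 - \<tau>" "t \<noteq> t0 + \<tau>" using ends t(3) by auto
    ultimately show ?thesis by (intro exI[of _ t]) auto
  qed
  have uniq: "t = t'" if "u \<in> ball u0 \<rho>" "\<bar>t - t0\<bar> \<le> \<tau>" "\<bar>t' - t0\<bar> \<le> \<tau>"
     "f (u + t *\<^sub>R v) = r" "f (u + t' *\<^sub>R v) = r" for u t t'
  proof -
    have "\<not> t < t'" if "u \<in> ball u0 \<rho>" "\<bar>t - t0\<bar> \<le> \<tau>" "\<bar>t' - t0\<bar> \<le> \<tau>"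
     "f (u + t *\<^sub>R v) = r" "f (u + t' *\<^sub>R v) = r" for t t'
    proof
      assume "t < t'"
      then have "0 < \<eta> * (t' - t)" using \<eta> by simp
      then show False using mono[OF that(1-3)] that(4,5) \<open>t < t'\<close> by simp
    qed
    from this[of t t'] this[of t' t] that show ?thesis by force
  qed
  define s where "s u = (SOME t. \<bar>t - t0\<bar> < \<tau> \<and> f (u + t *\<^sub>R v) = r)" for u
  have s: "\<bar>s u - t0\<bar> < \<tau>" "f (u + s u *\<^sub>R v) = r" if "u \<in> ball u0 \<rho>" for u
    using someI_ex[OF ex[OF that]] by (auto simp: s_def)
  have s_ge: "\<eta> * (t - s u) \<le> r - f (u + t *\<^sub>R v)" if "u \<in> ball u0 \<rho>" "\<bar>t - t0\<bar> < \<tau>" "s u \<le> t" for u t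
    using mono[of u "s u" t] s[OF that(1)] that by simp
  have s_lip1: "s u1 - s u2 \<le> (\<Lambda> / \<eta>) * norm (u1 - u2)" if u: "u1 \<in> ball u0 \<rho>" "u2 \<in> ball u0 \<rho>" for u1 u2
  proof (cases "s u2 \<le> s u1")
    case True
    have "\<eta> * (s u1 - s u2) \<le> r - f (u2 + s u1 *\<^sub>R v)"
      by (rule s_ge[OF u(2) s(1)[OF u(1)] True])
    also have "\<dots> = f (u1 + s u1 *\<^sub>R v) - f (u2 + s u1 *\<^sub>R v)" using s(2)[OF u(1)] by simp
    also have "\<dots> \<le> \<Lambda> * norm (u1 - u2)" using lip[of "u1 + s u1 *\<^sub>R v" "u2 + s u1 *\<^sub>R v"] by simp
    finally show ?thesis using \<eta> by (simp add: field_simps)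
  next
    case False
    have "0 \<le> (\<Lambda> / \<eta>) * norm (u1 - u2)" using \<Lambda> \<eta> by simp
    then show ?thesis using False by linarith
  qed
  have s_lip: "\<bar>s u1 - s u2\<bar> \<le> (\<Lambda> / \<eta>) * norm (u1 - u2)" if "u1 \<in> ball u0 \<rho>" "u2 \<in> ball u0 \<rho>" for u1 u2
    using s_lip1[OF that] s_lip1[OF that(2,1)] by (simp add: abs_le_iff norm_minus_commute)
  define K where "K = C * (1 + \<Lambda> / \<eta>)\<^sup>2 / \<eta>"
  have "semiconcave_on (ball u0 \<rho>) s"
  proof (rule concave_on_minus_norm_sq[OF convex_ball])
    fix u1 u2 \<alpha> \<beta> assume u: "u1 \<in> ball u0 \<rho>" "u2 \<in> ball u0 \<rho>" and lm: "0 \<le> \<alpha>" "0 \<le> \<beta>" "\<alpha> + \<beta> = (1::real)"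
    define u where "u = \<alpha> *\<^sub>R u1 + \<beta> *\<^sub>R u2"
    define t where "t = \<alpha> * s u1 + \<beta> * s u2"
    define y1 where "y1 = u1 + s u1 *\<^sub>R v"
    define y2 where "y2 = u2 + s u2 *\<^sub>R v"
    have uB: "u \<in> ball u0 \<rho>" using convexD[OF convex_ball u lm] by (simp add: u_def)
    have "t \<in> {t0 - \<tau><..<t0 + \<tau>}"
      using convexD[OF convex_real_interval(8) _ _ lm, of "s u1" "t0 - \<tau>" "t0 + \<tau>" "s u2"] s(1)[OF u(1)] s(1)[OF u(2)]
      by (auto simp: t_def abs_less_iff)
    then have tB: "\<bar>t - t0\<bar> < \<tau>" by auto
    have comb: "u + t *\<^sub>R v = \<alpha> *\<^sub>R y1 + \<beta> *\<^sub>R y2"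
      by (simp add: u_def t_def y1_def y2_def algebra_simps)
    have "u + t *\<^sub>R v \<in> U" "y1 \<in> U" "y2 \<in> U"
      using inball[OF uB] tB inball[OF u(1), of "s u1"] inball[OF u(2), of "s u2"] s(1)[OF u(1)] s(1)[OF u(2)] \<delta>(2)
      unfolding y1_def y2_def by (auto simp: less_imp_le)
    moreover from this obtain p where "supergradient U C f (u + t *\<^sub>R v) p" using sg by blast
    ultimately have "\<alpha> * f y1 + \<beta> * f y2 - C * (\<alpha> * \<beta> * (norm (y1 - y2))\<^sup>2) \<le> f (u + t *\<^sub>R v)"
      unfolding comb by (intro supergradient_semiconcavity lm)
    moreover have "\<alpha> * f y1 + \<beta> * f y2 = r"
      using s(2)[OF u(1)] s(2)[OF u(2)] lm by (simp add: y1_def y2_def flip: distrib_right)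
    ultimately have low: "r - f (u + t *\<^sub>R v) \<le> C * (\<alpha> * \<beta> * (norm (y1 - y2))\<^sup>2)" by linarith
    have "norm (y1 - y2) \<le> norm (u1 - u2) + norm ((s u1 - s u2) *\<^sub>R v)"
      using norm_triangle_ineq[of "u1 - u2" "(s u1 - s u2) *\<^sub>R v"] by (simp add: y1_def y2_def algebra_simps)
    also have "\<dots> \<le> (1 + \<Lambda> / \<eta>) * norm (u1 - u2)"
      using s_lip[OF u] v by (simp add: distrib_right)
    finally have "(norm (y1 - y2))\<^sup>2 \<le> ((1 + \<Lambda> / \<eta>) * norm (u1 - u2))\<^sup>2"
      by (intro power_mono) auto
    then have "C * (\<alpha> * \<beta> * (norm (y1 - y2))\<^sup>2) \<le> C * (\<alpha> * \<beta> * ((1 + \<Lambda> / \<eta>)\<^sup>2 * (norm (u1 - u2))\<^sup>2))"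
      using C lm by (intro mult_left_mono) (auto simp: power_mult_distrib)
    also have "\<dots> = \<eta> * (K * (\<alpha> * \<beta> * (norm (u1 - u2))\<^sup>2))" using \<eta> by (simp add: K_def)
    finally have high: "C * (\<alpha> * \<beta> * (norm (y1 - y2))\<^sup>2) \<le> \<eta> * (K * (\<alpha> * \<beta> * (norm (u1 - u2))\<^sup>2))" .
    show "\<alpha> * s u1 + \<beta> * s u2 - K * (\<alpha> * \<beta> * (norm (u1 - u2))\<^sup>2) \<le> s (\<alpha> *\<^sub>R u1 + \<beta> *\<^sub>R u2)"
      unfolding u_def[symmetric] t_def[symmetric]
    proof (cases "s u \<le> t")
      case True
      have "\<eta> * (t - s u) \<le> \<eta> * (K * (\<alpha> * \<beta> * (norm (u1 - u2))\<^sup>2))"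
        using s_ge[OF uB tB True] low high by linarith
      then have "t - s u \<le> K * (\<alpha> * \<beta> * (norm (u1 - u2))\<^sup>2)" using \<eta> by simp
      then show "t - K * (\<alpha> * \<beta> * (norm (u1 - u2))\<^sup>2) \<le> s u" by linarith
    next
      case False
      have "0 \<le> K * (\<alpha> * \<beta> * (norm (u1 - u2))\<^sup>2)" using C \<eta> lm by (simp add: K_def)
      then show "t - K * (\<alpha> * \<beta> * (norm (u1 - u2))\<^sup>2) \<le> s u" using False by linarith
    qed
  qed
  note semi = this
  have "subspace Q" unfolding Q_def by (rule subspace_hyperplane)
  moreover have "dim Q = DIM('a) - 1" unfolding Q_def using v by (intro dim_hyperplane) auto
  moreover have "open W" unfolding W_def
    by (intro open_Int open_Collect_less continuous_intros open_vimage[of "ball u0 \<rho>" "\<lambda>y. y - (v \<bullet> y) *\<^sub>R v", unfolded vimage_def] open_ball)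
  moreover have "x0 \<in> W" using \<rho> \<tau> by (simp add: W_def u0_def t0_def)
  moreover have "W \<subseteq> T"
  proof
    fix y assume "y \<in> W"
    then have "(y - (v \<bullet> y) *\<^sub>R v) + (v \<bullet> y) *\<^sub>R v \<in> ball x0 \<delta>"
      unfolding W_def by (intro inball) auto
    then show "y \<in> T" using \<delta>(2) by auto
  qed
  moreover have "openin (top_of_set Q) D" unfolding D_def by (rule openin_open_Int) simp
  moreover have "v \<noteq> 0" using v by auto
  moreover have "v \<in> orthogonal_comp Q"
    by (auto simp: orthogonal_comp_def orthogonal_def Q_def inner_commute)
  moreover have "locally_semiconcave_in Q D s" unfolding locally_semiconcave_in_def
  proof
    fix x assume "x \<in> D"
    then obtain e where e: "0 < e" "ball x e \<subseteq> ball u0 \<rho>" using openE[OF open_ball, of x u0 \<rho>] by (auto simp: D_def)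
    have "convex (ball x e \<inter> Q)" using \<open>subspace Q\<close> by (intro convex_Int convex_ball subspace_imp_convex)
    then have "semiconcave_on (ball x e \<inter> Q) s" using semi e(2) by (blast intro: semiconcave_on_subset)
    then show "\<exists>\<delta>>0. ball x \<delta> \<inter> Q \<subseteq> D \<and> semiconcave_on (ball x \<delta> \<inter> Q) s"
      using e by (intro exI[of _ e]) (auto simp: D_def)
  qed
  moreover have "{x. f x = r} \<inter> W = (\<lambda>u. u + s u *\<^sub>R v) ` D"
  proof (intro equalityI subsetI)
    fix y assume y: "y \<in> {x. f x = r} \<inter> W"
    define u where "u = y - (v \<bullet> y) *\<^sub>R v"
    have u: "u \<in> ball u0 \<rho>" "\<bar>v \<bullet> y - t0\<bar> < \<tau>" using y by (auto simp: W_def u_def)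
    have y_eq: "u + (v \<bullet> y) *\<^sub>R v = y" by (simp add: u_def)
    have "s u = v \<bullet> y" using uniq[OF u(1), of "s u" "v \<bullet> y"] s[OF u(1)] u(2) y y_eq by simp
    moreover have "u \<in> D" using u(1) vv by (simp add: D_def Q_def u_def inner_diff_right)
    ultimately show "y \<in> (\<lambda>u. u + s u *\<^sub>R v) ` D" using y_eq by (intro image_eqI[of _ _ u]) auto
  next
    fix y assume "y \<in> (\<lambda>u. u + s u *\<^sub>R v) ` D"
    then obtain u where u: "v \<bullet> u = 0" "u \<in> ball u0 \<rho>" "y = u + s u *\<^sub>R v" by (auto simp: D_def Q_def)
    have "v \<bullet> y = s u" using u(1) vv by (simp add: u(3) inner_add_right)
    then show "y \<in> {x. f x = r} \<inter> W" using s[OF u(2)] u by (simp add: W_def)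
  qed
  ultimately have "subspace Q \<and> dim Q = DIM('a) - 1 \<and> open W \<and> x0 \<in> W \<and> W \<subseteq> T \<and>
        openin (top_of_set Q) D \<and> v \<noteq> 0 \<and> v \<in> orthogonal_comp Q \<and>
        locally_semiconcave_in Q D s \<and> {x. f x = r} \<inter> W = (\<lambda>u. u + s u *\<^sub>R v) ` D"
    by (intro conjI)
  then show ?thesis by - (rule exI, rule exI, rule exI, rule exI, rule exI, assumption)
qed

lemma semiconcave_surface_descent_level_set:
  fixes f :: "'a::euclidean_space \<Rightarrow> real"
  assumes \<Lambda>: "0 < \<Lambda>" and lip: "\<And>x y. \<bar>f x - f y\<bar> \<le> \<Lambda> * norm (x - y)"
    and sg: "\<And>x. f x = r \<Longrightarrow> \<exists>U C. open U \<and> x \<in> U \<and> 0 \<le> C \<and> (\<forall>z\<in>U. \<exists>p. supergradient U C f z p)"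
    and ne: "{x. f x = r \<and> descent_point f x} \<noteq> {}"
  shows "semiconcave_surface {x. f x = r \<and> descent_point f x}"
  unfolding semiconcave_surface_def
proof (intro conjI ballI ne)
  let ?A = "{x. f x = r \<and> descent_point f x}"
  fix x assume "x \<in> ?A"
  then have x: "descent_point f x" "f x = r" by auto
  obtain U C where U: "open U" "x \<in> U" "0 \<le> C" "\<forall>z\<in>U. \<exists>p. supergradient U C f z p"
    using sg[OF x(2)] by blast
  have "x \<in> {x. descent_point f x}" using x by simp
  from level_set_semiconcave_graph[OF x U \<Lambda> lip open_descent_points this]
  obtain Q W D v s where *: "subspace Q \<and> dim Q = DIM('a) - 1 \<and> open W \<and> x \<in> W \<and> W \<subseteq> {x. descent_point f x} \<and>
        openin (top_of_set Q) D \<and> v \<noteq> 0 \<and> v \<in> orthogonal_comp Q \<and>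
        locally_semiconcave_in Q D s \<and> {x. f x = r} \<inter> W = (\<lambda>u. u + s u *\<^sub>R v) ` D"
    by (elim exE) (rule that)
  then have "?A \<inter> W = {x. f x = r} \<inter> W" by auto
  with * have "subspace Q \<and> dim Q = DIM('a) - 1 \<and> open W \<and> x \<in> W \<and>
        openin (top_of_set Q) D \<and> v \<noteq> 0 \<and> v \<in> orthogonal_comp Q \<and>
        locally_semiconcave_in Q D s \<and> ?A \<inter> W = (\<lambda>u. u + s u *\<^sub>R v) ` D"
    by simp
  then show "\<exists>Q W D v s. subspace Q \<and> dim Q = DIM('a) - 1 \<and> open W \<and> x \<in> W \<and>
        openin (top_of_set Q) D \<and> v \<noteq> 0 \<and> v \<in> orthogonal_comp Q \<and>
        locally_semiconcave_in Q D s \<and> ?A \<inter> W = (\<lambda>u. u + s u *\<^sub>R v) ` D"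
    by - (rule exI, rule exI, rule exI, rule exI, rule exI, assumption)
qed

section \<open>Distance spheres\<close>

theorem theorem4p4:
  fixes N :: "'a::euclidean_space \<Rightarrow> real" and F :: "'a set"
  assumes "DIM('a) \<ge> 2"
    and "is_norm N"
    and "norm_deriv_lipschitz_on_sphere N"
    and "equivalent_norms N norm"
    and "closed F" and "F \<noteq> {}"
  shows "\<exists>E. countable E \<and>
    (\<forall>r>0. r \<notin> E \<longrightarrow>
       dist_sphere N r F = {} \<or>
       (\<exists>A. semiconcave_surface A \<and>
            A \<subseteq> dist_sphere N r F \<and>
            openin (top_of_set (dist_sphere N r F)) A \<and>
            dist_sphere N r F \<subseteq> closure A \<and>
            hausdorff_measure (\<lambda>x y. N (x - y)) (DIM('a) - 1) (dist_sphere N r F - A) = 0))"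
proof -
  note dim = assms(1) and N = assms(2) and eqv = assms(4) and F = assms(5,6)
  obtain a b L G where "smooth_norm N a b L G"
    using smooth_norm_exists[OF assms(2-4)] .
  then interpret smooth_norm N a b L G .
  let ?d = "\<lambda>x. dist_fun N x F"
  let ?H = "hausdorff_measure (\<lambda>x y. N (x - y)) (DIM('a) - 1)"
  have cont: "continuous_on S ?d" for S by (rule continuous_dist_fun[OF F])
  obtain \<G> where \<G>: "countable \<G>" "{x. 0 < ?d x \<and> \<not> descent_point ?d x} \<subseteq> \<Union>\<G>"
    "\<And>S. S \<in> \<G> \<Longrightarrow> bounded S \<and> (\<exists>v. transversal v S)"
    using nondescent_points_countable_transversal[OF F] by blast
  \<comment> \<open>the empty set is added because an enumeration needs a nonempty family\<close>
  define \<G>' where "\<G>' = insert {} \<G>"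
  have \<G>': "countable \<G>'" "\<G>' \<noteq> {}" using \<G>(1) by (auto simp: \<G>'_def)
  define S where "S j = closure (from_nat_into \<G>' j)" for j
  have S: "compact (S j) \<and> (\<exists>v. transversal v (S j))" for j
  proof (cases "from_nat_into \<G>' j = {}")
    case True
    obtain v :: 'a where "norm v = 1" using vector_choose_size[of 1] by auto
    then have "transversal v {}" by (simp add: transversal_def)
    then show ?thesis using True by (auto simp: S_def)
  next
    case False
    then have "from_nat_into \<G>' j \<in> \<G>" using from_nat_into[OF \<G>'(2), of j] by (simp add: \<G>'_def)
    from \<G>(3)[OF this] obtain v where "bounded (from_nat_into \<G>' j)" "transversal v (from_nat_into \<G>' j)"
      by auto
    then show ?thesis unfolding S_def using transversal_closure[of v] by (auto simp: compact_closure)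
  qed
  have cover: "{x. 0 < ?d x \<and> \<not> descent_point ?d x} \<subseteq> (\<Union>j. S j)"
  proof
    fix x assume "x \<in> {x. 0 < ?d x \<and> \<not> descent_point ?d x}"
    then obtain X where X: "X \<in> \<G>'" "x \<in> X" using \<G>(2) by (auto simp: \<G>'_def)
    then obtain j where "from_nat_into \<G>' j = X" using from_nat_into_surj[OF \<G>'(1)] by blast
    then show "x \<in> (\<Union>j. S j)" using X(2) closure_subset unfolding S_def by blast
  qed
  \<comment> \<open>levels that are not null on some transversal piece, local maximum values, local minimum values\<close>
  define E where "E = (\<Union>j. {r. ?H {x \<in> S j. ?d x = r} \<noteq> 0})
    \<union> {r. \<exists>x U. ?d x = r \<and> open U \<and> x \<in> U \<and> (\<forall>y\<in>U. ?d y \<le> r)}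
    \<union> uminus ` {r. \<exists>x U. - ?d x = r \<and> open U \<and> x \<in> U \<and> (\<forall>y\<in>U. - ?d y \<le> r)}"
  have "countable {r. ?H {x \<in> S j. ?d x = r} \<noteq> 0}" for j
    using countable_nonnull_levels[OF N eqv dim _ _ cont] S[of j] by blast
  then have "countable E" unfolding E_def
    by (intro countable_Un countable_UN countable_image countable_local_max_values) auto
  moreover have "\<exists>A. semiconcave_surface A \<and> A \<subseteq> dist_sphere N r F \<and>
            openin (top_of_set (dist_sphere N r F)) A \<and> dist_sphere N r F \<subseteq> closure A \<and>
            ?H (dist_sphere N r F - A) = 0"
    if r: "0 < r" "r \<notin> E" and ne: "dist_sphere N r F \<noteq> {}" for r
  proof -
    define A where "A = {x. ?d x = r \<and> descent_point ?d x}"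
    have A: "A = dist_sphere N r F \<inter> {x. descent_point ?d x}" by (auto simp: A_def dist_sphere_def)
    have "?H (\<Union>j. {x \<in> S j. ?d x = r}) = 0"
      using r(2) dim by (intro hausdorff_null_UN[OF N eqv]) (auto simp: E_def)
    moreover have "dist_sphere N r F - A \<subseteq> (\<Union>j. {x \<in> S j. ?d x = r})"
      using cover r(1) by (auto simp: A_def dist_sphere_def)
    ultimately have null: "?H (dist_sphere N r F - A) = 0"
      using hausdorff_null_subset by blast
    have dense: "dist_sphere N r F \<subseteq> closure A"
    proof
      fix x assume x: "x \<in> dist_sphere N r F"
      show "x \<in> closure A"
      proof (rule ccontr)
        assume "x \<notin> closure A"
        then obtain e where e: "0 < e" "ball x e \<subseteq> - closure A"
          using openE[of "- closure A" x] by auto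
        have dx: "?d x = r" using x by (simp add: dist_sphere_def)
        have "\<exists>y\<in>ball x e. r < ?d y"
        proof (rule ccontr)
          assume "\<not> ?thesis"
          then have "\<forall>y\<in>ball x e. ?d y \<le> r" by auto
          then have "r \<in> E" using dx e(1) unfolding E_def
            by (intro UnI1 UnI2 CollectI exI[of _ x] exI[of _ "ball x e"]) auto
          then show False using r(2) by simp
        qed
        moreover have "\<exists>y\<in>ball x e. ?d y < r"
        proof (rule ccontr)
          assume "\<not> ?thesis"
          then have "\<forall>y\<in>ball x e. - ?d y \<le> - r" by auto
          then have "r \<in> E" using dx e(1) unfolding E_def
            by (intro UnI2 image_eqI[of _ _ "- r"] CollectI exI[of _ x] exI[of _ "ball x e"]) auto
          then show False using r(2) by simp
        qed
        ultimately obtain y z where "y \<in> ball x e" "?d y < r" "z \<in> ball x e" "r < ?d z" by blast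
        then have "?H (ball x e \<inter> {x. ?d x = r}) \<noteq> 0"
          by (intro level_set_not_hausdorff_null[OF N eqv dim open_ball convex_ball cont])
        moreover have "ball x e \<inter> {x. ?d x = r} \<subseteq> dist_sphere N r F - A"
          using e(2) closure_subset[of A] by (auto simp: dist_sphere_def)
        ultimately show False using null hausdorff_null_subset by blast
      qed
    qed
    have "semiconcave_surface A" unfolding A_def
    proof (rule semiconcave_surface_descent_level_set)
      show "0 < 1 / a" using a by simp
      show "\<bar>?d x - ?d y\<bar> \<le> 1 / a * norm (x - y)" for x y using dist_fun_lipschitz[OF F, of x y] by simp
      show "{x. ?d x = r \<and> descent_point ?d x} \<noteq> {}" using dense ne unfolding A_def[symmetric] by auto
      fix x assume "?d x = r"
      then have "0 < ?d x" using r(1) by simp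
      from dist_fun_supergradients[OF F this] obtain R C m M where R: "0 < R" "0 \<le> C" "0 < m"
        "\<And>z. z \<in> ball x R \<Longrightarrow> \<exists>p. m \<le> norm p \<and> norm p \<le> M \<and> supergradient (ball x R) C ?d z p"
        by blast
      have "\<forall>z\<in>ball x R. \<exists>p. supergradient (ball x R) C ?d z p" using R(4) by blast
      with R(1,2) show "\<exists>U C. open U \<and> x \<in> U \<and> 0 \<le> C \<and> (\<forall>z\<in>U. \<exists>p. supergradient U C ?d z p)"
        by (intro exI[of _ "ball x R"] exI[of _ C]) simp
    qed
    moreover have "openin (top_of_set (dist_sphere N r F)) A"
      unfolding A by (rule openin_open_Int[OF open_descent_points])
    moreover have "A \<subseteq> dist_sphere N r F" by (simp add: A)
    ultimately show ?thesis using dense null by blast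
  qed
  ultimately show ?thesis by blast
qed

end
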